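(* Let $\mathcal{K}$ be a Fraïssé class whose Fraïssé symmetry $(\mathbb{D}_\mathcal{K},G_\mathcal{K})$ is well-behaved. Then the category of single-orbit nominal $G_\mathcal{K}$-sets and equivariant functions is equivalent to the category whose - objects are pairs $(\mathfrak{A},S)$ with $\mathfrak{A}\in\mathcal{K}$ and $S\le\mathrm{Aut}(\mathfrak{A})$; - morphisms from $(\mathfrak{A},S)$ to $(\mathfrak{B},T)$ are $\equiv_T$-classes of embeddings $u:\mathfrak{B}\to\mathfrak{A}$ such that for every $\sigma\in S$ there is $\tau\in T$ with $\sigma\circ u=u\circ\tau$ (where $u\equiv_T v$ iff $v=u\circ\tau$ for some $\tau\in T$), with composition induced by composition of representing embeddings.
   Context: Fix a finite relational signature; embeddings are injective maps preserving and reflecting all relations. A Fraïssé class $\mathcal{K}$ is a class of finite structures closed under isomorphism and substructures, with amalgamation (any two embeddings $\mathfrak{A}\to\mathfrak{B}$, $\mathfrak{A}\to\mathfrak{C}$ within $\mathcal{K}$ can be completed by embeddings $\mathfrak{B}\to\mathfrak{D}$, $\mathfrak{C}\to\mathfrak{D}$, $\mathfrak{D}\in\mathcal{K}$, agreeing on $\mathfrak{A}$). The Fraïssé limit $\mathfrak{U}_\mathcal{K}$ is the countable homogeneous structure (every isomorphism between finite substructures extends to an automorphism) whose finite substructures are, up to isomorphism, exactly $\mathcal{K}$. $\mathbb{D}_\mathcal{K}$ is its carrier and $G_\mathcal{K}=\mathrm{Aut}(\mathfrak{U}_\mathcal{K})$. A $G_\mathcal{K}$-set (set with right action) is nominal if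 each element $x$ has a finite $C\subseteq\mathbb{D}_\mathcal{K}$ with $x\cdot\pi=x$ for all $\pi$ fixing $C$ pointwise; single-orbit means one orbit. Well-behaved: every element of every nominal $G_\mathcal{K}$-set has a least finite support, and every finite $C\subseteq\mathbb{D}_\mathcal{K}$ is fungible (for each $c\in C$ some $\pi\in G_\mathcal{K}$ moves $c$ and fixes $C\setminus\{c\}$ pointwise). *)

theory Defs
  imports "HOL-Algebra.Group" "HOL-Library.Countable_Set"
begin

section \<open>Relational structures\<close>

text \<open>A signature is a set of relation symbols, with arities. It is not modelled as a type of
  class finite, because that would exclude the empty signature.\<close>

record 'r signature =
  syms :: "'r set"
  arity :: "'r \<Rightarrow> nat"

record ('a, 'r) relstruct =
  univ :: "'a set"
  rel :: "'r \<Rightarrow> 'a list set"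

definition tuples :: "'r signature \<Rightarrow> 'r \<Rightarrow> 'a set \<Rightarrow> 'a list set" where
  "tuples \<Sigma> r X = {xs. set xs \<subseteq> X \<and> length xs = arity \<Sigma> r}"

definition is_structure :: "'r signature \<Rightarrow> ('a, 'r) relstruct \<Rightarrow> bool" where
  "is_structure \<Sigma> A \<longleftrightarrow>
     (\<forall>r \<in> syms \<Sigma>. rel A r \<subseteq> tuples \<Sigma> r (univ A)) \<and> (\<forall>r. r \<notin> syms \<Sigma> \<longrightarrow> rel A r = {})"

definition induced :: "('a, 'r) relstruct \<Rightarrow> 'a set \<Rightarrow> ('a, 'r) relstruct" where
  "induced A X = \<lparr>univ = X, rel = (\<lambda>r. {xs \<in> rel A r. set xs \<subseteq> X})\<rparr>"

text \<open>Maps between structures are extensional functions, so that equality of HOL functions is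
  equality of maps; accordingly they are composed with \<^const>\<open>compose\<close>.\<close>

definition embeddings ::
    "'r signature \<Rightarrow> ('a, 'r) relstruct \<Rightarrow> ('b, 'r) relstruct \<Rightarrow> ('a \<Rightarrow> 'b) set" where
  "embeddings \<Sigma> A B =
     {f \<in> univ A \<rightarrow>\<^sub>E univ B. inj_on f (univ A) \<and>
        (\<forall>r \<in> syms \<Sigma>. \<forall>xs \<in> tuples \<Sigma> r (univ A). xs \<in> rel A r \<longleftrightarrow> map f xs \<in> rel B r)}"

definition isomorphisms ::
    "'r signature \<Rightarrow> ('a, 'r) relstruct \<Rightarrow> ('b, 'r) relstruct \<Rightarrow> ('a \<Rightarrow> 'b) set" where
  "isomorphisms \<Sigma> A B = {f \<in> embeddings \<Sigma> A B. f ` univ A = univ B}"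

definition isomorphic ::
    "'r signature \<Rightarrow> ('a, 'r) relstruct \<Rightarrow> ('b, 'r) relstruct \<Rightarrow> bool" where
  "isomorphic \<Sigma> A B \<longleftrightarrow> isomorphisms \<Sigma> A B \<noteq> {}"

text \<open>The product of \<open>\<pi>\<close> and \<open>\<sigma>\<close> is ``first \<open>\<pi>\<close>, then \<open>\<sigma>\<close>'', so that \<open>d \<cdot> \<pi> = \<pi> d\<close> is a right
  action. Which sets of automorphisms are subgroups does not depend on this convention.\<close>

definition aut_group :: "'r signature \<Rightarrow> ('a, 'r) relstruct \<Rightarrow> ('a \<Rightarrow> 'a) monoid" where
  "aut_group \<Sigma> A =
     \<lparr>carrier = isomorphisms \<Sigma> A A,
      mult = (\<lambda>\<pi> \<sigma>. compose (univ A) \<sigma> \<pi>),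
      one = (\<lambda>x \<in> univ A. x)\<rparr>"


section \<open>Fraisse classes and limits\<close>

definition fraisse_class :: "'r signature \<Rightarrow> ('a, 'r) relstruct set \<Rightarrow> bool" where
  "fraisse_class \<Sigma> K \<longleftrightarrow>
     (\<forall>A \<in> K. is_structure \<Sigma> A \<and> finite (univ A)) \<and>
     (\<forall>A \<in> K. \<forall>B. is_structure \<Sigma> B \<and> isomorphic \<Sigma> A B \<longrightarrow> B \<in> K) \<and>
     (\<forall>A \<in> K. \<forall>X \<subseteq> univ A. induced A X \<in> K) \<and>
     (\<forall>A \<in> K. \<forall>B \<in> K. \<forall>C \<in> K. \<forall>f \<in> embeddings \<Sigma> A B. \<forall>g \<in> embeddings \<Sigma> A C.
        \<exists>D \<in> K. \<exists>f' \<in> embeddings \<Sigma> B D. \<exists>g' \<in> embeddings \<Sigma> C D.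
          compose (univ A) f' f = compose (univ A) g' g)"

definition homogeneous :: "'r signature \<Rightarrow> ('d, 'r) relstruct \<Rightarrow> bool" where
  "homogeneous \<Sigma> U \<longleftrightarrow>
     (\<forall>X Y. \<forall>f \<in> isomorphisms \<Sigma> (induced U X) (induced U Y).
        X \<subseteq> univ U \<and> Y \<subseteq> univ U \<and> finite X \<and> finite Y \<longrightarrow>
        (\<exists>\<pi> \<in> carrier (aut_group \<Sigma> U). \<forall>x \<in> X. \<pi> x = f x))"

definition fraisse_limit ::
    "'r signature \<Rightarrow> ('a, 'r) relstruct set \<Rightarrow> ('d, 'r) relstruct \<Rightarrow> bool" where
  "fraisse_limit \<Sigma> K U \<longleftrightarrow>
     is_structure \<Sigma> U \<and> countable (univ U) \<and> homogeneous \<Sigma> U \<and>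
     (\<forall>X. X \<subseteq> univ U \<and> finite X \<longrightarrow> (\<exists>A \<in> K. isomorphic \<Sigma> A (induced U X))) \<and>
     (\<forall>A \<in> K. \<exists>X. X \<subseteq> univ U \<and> finite X \<and> isomorphic \<Sigma> A (induced U X))"


section \<open>Nominal sets over a data symmetry\<close>

text \<open>Throughout, \<open>D\<close> is the set of data values and \<open>G\<close> is a group of permutations of \<open>D\<close>.\<close>

record ('x, 'g) gset =
  gcarrier :: "'x set"
  gact :: "'x \<Rightarrow> 'g \<Rightarrow> 'x"

definition is_gset :: "('g, 'm) monoid_scheme \<Rightarrow> ('x, 'g) gset \<Rightarrow> bool" where
  "is_gset G X \<longleftrightarrow>
     gact X \<in> gcarrier X \<rightarrow>\<^sub>E (carrier G \<rightarrow>\<^sub>E gcarrier X) \<and>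
     (\<forall>x \<in> gcarrier X. gact X x \<one>\<^bsub>G\<^esub> = x) \<and>
     (\<forall>x \<in> gcarrier X. \<forall>\<pi> \<in> carrier G. \<forall>\<sigma> \<in> carrier G.
        gact X x (\<pi> \<otimes>\<^bsub>G\<^esub> \<sigma>) = gact X (gact X x \<pi>) \<sigma>)"

definition equivariant_maps ::
    "('g, 'm) monoid_scheme \<Rightarrow> ('x, 'g) gset \<Rightarrow> ('y, 'g) gset \<Rightarrow> ('x \<Rightarrow> 'y) set" where
  "equivariant_maps G X Y =
     {f \<in> gcarrier X \<rightarrow>\<^sub>E gcarrier Y.
        \<forall>x \<in> gcarrier X. \<forall>\<pi> \<in> carrier G. f (gact X x \<pi>) = gact Y (f x) \<pi>}"

definition single_orbit :: "('g, 'm) monoid_scheme \<Rightarrow> ('x, 'g) gset \<Rightarrow> bool" where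
  "single_orbit G X \<longleftrightarrow> (\<exists>x \<in> gcarrier X. gcarrier X = gact X x ` carrier G)"

definition supports ::
    "('d \<Rightarrow> 'd, 'm) monoid_scheme \<Rightarrow> ('x, 'd \<Rightarrow> 'd) gset \<Rightarrow> 'd set \<Rightarrow> 'x \<Rightarrow> bool" where
  "supports G X C x \<longleftrightarrow> (\<forall>\<pi> \<in> carrier G. (\<forall>c \<in> C. \<pi> c = c) \<longrightarrow> gact X x \<pi> = x)"

definition finite_support ::
    "'d set \<Rightarrow> ('d \<Rightarrow> 'd, 'm) monoid_scheme \<Rightarrow> ('x, 'd \<Rightarrow> 'd) gset \<Rightarrow> 'd set \<Rightarrow> 'x \<Rightarrow> bool" where
  "finite_support D G X C x \<longleftrightarrow> finite C \<and> C \<subseteq> D \<and> supports G X C x"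

definition nominal ::
    "'d set \<Rightarrow> ('d \<Rightarrow> 'd, 'm) monoid_scheme \<Rightarrow> ('x, 'd \<Rightarrow> 'd) gset \<Rightarrow> bool" where
  "nominal D G X \<longleftrightarrow> is_gset G X \<and> (\<forall>x \<in> gcarrier X. \<exists>C. finite_support D G X C x)"

definition fungible :: "('d \<Rightarrow> 'd, 'm) monoid_scheme \<Rightarrow> 'd set \<Rightarrow> bool" where
  "fungible G C \<longleftrightarrow>
     (\<forall>c \<in> C. \<exists>\<pi> \<in> carrier G. \<pi> c \<noteq> c \<and> (\<forall>c' \<in> C - {c}. \<pi> c' = c'))"

text \<open>The type \<open>'x\<close> is the universe from which the carriers of nominal sets are taken. Orbits of
  nominal sets over a countable \<open>D\<close> are countable, and the supports of an element only depend on
  its orbit; hence every infinite type \<open>'x\<close> gives the same notion.\<close>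

definition well_behaved ::
    "'x itself \<Rightarrow> 'd set \<Rightarrow> ('d \<Rightarrow> 'd, 'm) monoid_scheme \<Rightarrow> bool" where
  "well_behaved (u :: 'x itself) D G \<longleftrightarrow>
     (\<forall>X :: ('x, 'd \<Rightarrow> 'd) gset. nominal D G X \<longrightarrow>
        (\<forall>x \<in> gcarrier X. \<exists>C. finite_support D G X C x \<and>
           (\<forall>C'. finite_support D G X C' x \<longrightarrow> C \<subseteq> C'))) \<and>
     (\<forall>C. finite C \<and> C \<subseteq> D \<longrightarrow> fungible G C)"


section \<open>Categories and their equivalence\<close>

text \<open>\<open>Cmp C X Y Z g f\<close> is \<open>g \<circ> f\<close> for \<open>f : X \<rightarrow> Y\<close> and \<open>g : Y \<rightarrow> Z\<close>. Hom-sets need not be disjoint.\<close>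

record ('o, 'm) category =
  Obj :: "'o set"
  Arr :: "'o \<Rightarrow> 'o \<Rightarrow> 'm set"
  Ide :: "'o \<Rightarrow> 'm"
  Cmp :: "'o \<Rightarrow> 'o \<Rightarrow> 'o \<Rightarrow> 'm \<Rightarrow> 'm \<Rightarrow> 'm"

definition is_category :: "('o, 'm) category \<Rightarrow> bool" where
  "is_category C \<longleftrightarrow>
     (\<forall>X \<in> Obj C. Ide C X \<in> Arr C X X) \<and>
     (\<forall>X \<in> Obj C. \<forall>Y \<in> Obj C. \<forall>Z \<in> Obj C. \<forall>f \<in> Arr C X Y. \<forall>g \<in> Arr C Y Z.
        Cmp C X Y Z g f \<in> Arr C X Z) \<and>
     (\<forall>X \<in> Obj C. \<forall>Y \<in> Obj C. \<forall>f \<in> Arr C X Y.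
        Cmp C X X Y f (Ide C X) = f \<and> Cmp C X Y Y (Ide C Y) f = f) \<and>
     (\<forall>W \<in> Obj C. \<forall>X \<in> Obj C. \<forall>Y \<in> Obj C. \<forall>Z \<in> Obj C.
        \<forall>f \<in> Arr C W X. \<forall>g \<in> Arr C X Y. \<forall>h \<in> Arr C Y Z.
          Cmp C W X Z (Cmp C X Y Z h g) f = Cmp C W Y Z h (Cmp C W X Y g f))"

definition is_functor ::
    "('o, 'm) category \<Rightarrow> ('p, 'n) category \<Rightarrow> ('o \<Rightarrow> 'p) \<Rightarrow> ('o \<Rightarrow> 'o \<Rightarrow> 'm \<Rightarrow> 'n) \<Rightarrow> bool" where
  "is_functor C D F0 F1 \<longleftrightarrow>
     (\<forall>X \<in> Obj C. F0 X \<in> Obj D) \<and>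
     (\<forall>X \<in> Obj C. \<forall>Y \<in> Obj C. \<forall>f \<in> Arr C X Y. F1 X Y f \<in> Arr D (F0 X) (F0 Y)) \<and>
     (\<forall>X \<in> Obj C. F1 X X (Ide C X) = Ide D (F0 X)) \<and>
     (\<forall>X \<in> Obj C. \<forall>Y \<in> Obj C. \<forall>Z \<in> Obj C. \<forall>f \<in> Arr C X Y. \<forall>g \<in> Arr C Y Z.
        F1 X Z (Cmp C X Y Z g f) = Cmp D (F0 X) (F0 Y) (F0 Z) (F1 Y Z g) (F1 X Y f))"

definition is_iso :: "('o, 'm) category \<Rightarrow> 'o \<Rightarrow> 'o \<Rightarrow> 'm \<Rightarrow> bool" where
  "is_iso C X Y f \<longleftrightarrow>
     f \<in> Arr C X Y \<and>
     (\<exists>g \<in> Arr C Y X. Cmp C X Y X g f = Ide C X \<and> Cmp C Y X Y f g = Ide C Y)"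

definition natural_iso ::
    "('o, 'm) category \<Rightarrow> ('p, 'n) category \<Rightarrow> ('o \<Rightarrow> 'p) \<Rightarrow> ('o \<Rightarrow> 'o \<Rightarrow> 'm \<Rightarrow> 'n) \<Rightarrow>
     ('o \<Rightarrow> 'p) \<Rightarrow> ('o \<Rightarrow> 'o \<Rightarrow> 'm \<Rightarrow> 'n) \<Rightarrow> ('o \<Rightarrow> 'n) \<Rightarrow> bool" where
  "natural_iso C D F0 F1 G0 G1 \<eta> \<longleftrightarrow>
     (\<forall>X \<in> Obj C. is_iso D (F0 X) (G0 X) (\<eta> X)) \<and>
     (\<forall>X \<in> Obj C. \<forall>Y \<in> Obj C. \<forall>f \<in> Arr C X Y.
        Cmp D (F0 X) (F0 Y) (G0 Y) (\<eta> Y) (F1 X Y f) =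
        Cmp D (F0 X) (G0 X) (G0 Y) (G1 X Y f) (\<eta> X))"

definition equivalent_categories :: "('o, 'm) category \<Rightarrow> ('p, 'n) category \<Rightarrow> bool" where
  "equivalent_categories C D \<longleftrightarrow>
     is_category C \<and> is_category D \<and>
     (\<exists>F0 F1 G0 G1 \<eta> \<epsilon>.
        is_functor C D F0 F1 \<and> is_functor D C G0 G1 \<and>
        natural_iso C C (\<lambda>X. X) (\<lambda>X Y f. f)
          (\<lambda>X. G0 (F0 X)) (\<lambda>X Y f. G1 (F0 X) (F0 Y) (F1 X Y f)) \<eta> \<and>
        natural_iso D D (\<lambda>X. F0 (G0 X)) (\<lambda>X Y f. F1 (G0 X) (G0 Y) (G1 X Y f))
          (\<lambda>X. X) (\<lambda>X Y f. f) \<epsilon>)"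


section \<open>The two categories\<close>

definition single_orbit_nominal_cat ::
    "'d set \<Rightarrow> ('d \<Rightarrow> 'd, 'm) monoid_scheme \<Rightarrow> (('x, 'd \<Rightarrow> 'd) gset, 'x \<Rightarrow> 'x) category" where
  "single_orbit_nominal_cat D G =
     \<lparr>Obj = {X. nominal D G X \<and> single_orbit G X},
      Arr = equivariant_maps G,
      Ide = (\<lambda>X. \<lambda>x \<in> gcarrier X. x),
      Cmp = (\<lambda>X Y Z g f. compose (gcarrier X) g f)\<rparr>"

text \<open>The relation \<open>\<equiv>\<^sub>T\<close> on embeddings of \<open>B\<close> into \<open>A\<close>.\<close>

definition emb_equiv ::
    "'r signature \<Rightarrow> ('a, 'r) relstruct \<Rightarrow> ('a, 'r) relstruct \<Rightarrow> ('a \<Rightarrow> 'a) set \<Rightarrow>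
     (('a \<Rightarrow> 'a) \<times> ('a \<Rightarrow> 'a)) set" where
  "emb_equiv \<Sigma> B A T =
     {(u, v). u \<in> embeddings \<Sigma> B A \<and> v \<in> embeddings \<Sigma> B A \<and>
        (\<exists>\<tau> \<in> T. v = compose (univ B) u \<tau>)}"

definition admissible_embeddings ::
    "'r signature \<Rightarrow> ('a, 'r) relstruct \<times> ('a \<Rightarrow> 'a) set \<Rightarrow>
     ('a, 'r) relstruct \<times> ('a \<Rightarrow> 'a) set \<Rightarrow> ('a \<Rightarrow> 'a) set" where
  "admissible_embeddings \<Sigma> = (\<lambda>(A, S) (B, T).
     {u \<in> embeddings \<Sigma> B A.
        \<forall>\<sigma> \<in> S. \<exists>\<tau> \<in> T. compose (univ B) \<sigma> u = compose (univ B) u \<tau>})"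

text \<open>A morphism from \<open>(A, S)\<close> to \<open>(B, T)\<close> is a class of embeddings \<open>B \<rightarrow> A\<close>. For
  \<open>f : (A, S) \<rightarrow> (B, T)\<close> and \<open>g : (B, T) \<rightarrow> (C, R)\<close> the composite is the class of \<open>u \<circ> v\<close> for any
  representatives \<open>u \<in> f\<close> and \<open>v \<in> g\<close>; since all of them yield the same class, it is written as
  the union over all representatives.\<close>

definition structure_subgroup_cat ::
    "'r signature \<Rightarrow> ('a, 'r) relstruct set \<Rightarrow>
     (('a, 'r) relstruct \<times> ('a \<Rightarrow> 'a) set, ('a \<Rightarrow> 'a) set) category" where
  "structure_subgroup_cat \<Sigma> K =
     \<lparr>Obj = {(A, S). A \<in> K \<and> subgroup S (aut_group \<Sigma> A)},
      Arr = (\<lambda>(A, S) (B, T). admissible_embeddings \<Sigma> (A, S) (B, T) // emb_equiv \<Sigma> B A T),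
      Ide = (\<lambda>(A, S). emb_equiv \<Sigma> A A S `` {\<lambda>x \<in> univ A. x}),
      Cmp = (\<lambda>(A, S) (B, T) (C, R) g f.
               \<Union>u \<in> f. \<Union>v \<in> g. emb_equiv \<Sigma> C A R `` {compose (univ C) u v})\<rparr>"

end

theory Submission
  imports Defs
begin

text \<open>
  The object \<open>(A, S)\<close> is sent to the set of embeddings of \<open>A\<close> into the limit \<open>U\<close>, taken modulo
  \<open>S\<close>, on which automorphisms of \<open>U\<close> act by postcomposition; an admissible embedding \<open>u\<close> acts on it
  by \<open>[e] \<mapsto> [e \<circ> u]\<close>. Homogeneity of \<open>U\<close> gives a single orbit. Fungibility forces the least support
  of \<open>[e]\<close> to be the whole image of \<open>e\<close>; hence, if an equivariant map sends \<open>[e]\<close> to \<open>[e']\<close>, the image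
  of \<open>e'\<close> lies in that of \<open>e\<close> and \<open>e'\<close> factors as \<open>e \<circ> u\<close>, which yields fullness. For essential
  surjectivity, take an element \<open>x\<close> of an orbit and an \<open>A\<close> in \<open>K\<close> isomorphic to its least support;
  \<open>S\<close> consists of the automorphisms of \<open>A\<close> induced by the stabilizer of \<open>x\<close>.
\<close>

text \<open>The stabilizer of \<open>[e]\<close> consists of the automorphisms of \<open>U\<close>
  that act on the image of \<open>e\<close> as an element of \<open>S\<close> does. Postcomposition
  commutes with precomposition, which explains the reversed direction of the embeddings:
  \<open>u\<close> from \<open>B\<close> to \<open>A\<close> induces a map from the orbit of
  \<open>(A, S)\<close> to the orbit of \<open>(B, T)\<close>, and admissibility of \<open>u\<close>
  says precisely that this map respects the classes. Least supports serve a second purpose besides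
  locating images: an automorphism that fixes \<open>x\<close> must preserve the least support of
  \<open>x\<close>, and so induces an automorphism of \<open>A\<close>. The carriers must live in
  the given infinite type \<open>'x\<close>, so the orbit of classes is available only through a
  chosen coding, and an orbit has no preferred structure \<open>A\<close> attached to it either. The
  inverse functor is therefore not written down but obtained from full faithfulness and essential
  surjectivity.\<close>

section \<open>Fully faithful and essentially surjective functors\<close>

context
  fixes C :: "('o, 'm) category"
  assumes cat: "is_category C"
begin

lemma category_Ide: "X \<in> Obj C \<Longrightarrow> Ide C X \<in> Arr C X X"
  using cat unfolding is_category_def by blast

lemma category_Cmp:
  "\<lbrakk>X \<in> Obj C; Y \<in> Obj C; Z \<in> Obj C; f \<in> Arr C X Y; g \<in> Arr C Y Z\<rbrakk>
    \<Longrightarrow> Cmp C X Y Z g f \<in> Arr C X Z"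
  using cat unfolding is_category_def by blast

lemma category_Ide_right:
  "\<lbrakk>X \<in> Obj C; Y \<in> Obj C; f \<in> Arr C X Y\<rbrakk> \<Longrightarrow> Cmp C X X Y f (Ide C X) = f"
  using cat unfolding is_category_def by blast

lemma category_Ide_left:
  "\<lbrakk>X \<in> Obj C; Y \<in> Obj C; f \<in> Arr C X Y\<rbrakk> \<Longrightarrow> Cmp C X Y Y (Ide C Y) f = f"
  using cat unfolding is_category_def by blast

lemma category_assoc:
  "\<lbrakk>W \<in> Obj C; X \<in> Obj C; Y \<in> Obj C; Z \<in> Obj C;
    f \<in> Arr C W X; g \<in> Arr C X Y; h \<in> Arr C Y Z\<rbrakk>
    \<Longrightarrow> Cmp C W X Z (Cmp C X Y Z h g) f = Cmp C W Y Z h (Cmp C W X Y g f)"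
  using cat unfolding is_category_def by blast

end

text \<open>The inverse functor transports an arrow of \<open>C\<close> along chosen isomorphisms
  \<open>t\<close> and lifts the result through \<open>F1\<close>. Every equation between arrows of
  \<open>D\<close> is proved by applying \<open>F1\<close> and appealing to faithfulness.\<close>

lemma equivalent_categories_if_fully_faithful_ess_surj:
  assumes C: "is_category C" and D: "is_category D" and F: "is_functor D C F0 F1"
    and full: "\<And>X Y f. \<lbrakk>X \<in> Obj D; Y \<in> Obj D; f \<in> Arr C (F0 X) (F0 Y)\<rbrakk>
      \<Longrightarrow> \<exists>g \<in> Arr D X Y. F1 X Y g = f"
    and faithful: "\<And>X Y g h. \<lbrakk>X \<in> Obj D; Y \<in> Obj D; g \<in> Arr D X Y; h \<in> Arr D X Y;
      F1 X Y g = F1 X Y h\<rbrakk> \<Longrightarrow> g = h"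
    and ess_surj: "\<And>Z. Z \<in> Obj C \<Longrightarrow> \<exists>X \<in> Obj D. \<exists>t. is_iso C Z (F0 X) t"
  shows "equivalent_categories C D"
proof -
  have Fo: "F0 X \<in> Obj C" if "X \<in> Obj D" for X
    using F that unfolding is_functor_def by blast
  have Fa: "F1 X Y f \<in> Arr C (F0 X) (F0 Y)" if "X \<in> Obj D" "Y \<in> Obj D" "f \<in> Arr D X Y" for X Y f
    using F that unfolding is_functor_def by blast
  have Fi: "F1 X X (Ide D X) = Ide C (F0 X)" if "X \<in> Obj D" for X
    using F that unfolding is_functor_def by blast
  have Fc: "F1 X Z (Cmp D X Y Z g f) = Cmp C (F0 X) (F0 Y) (F0 Z) (F1 Y Z g) (F1 X Y f)"
    if "X \<in> Obj D" "Y \<in> Obj D" "Z \<in> Obj D" "f \<in> Arr D X Y" "g \<in> Arr D Y Z" for X Y Z f g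
    using F that unfolding is_functor_def by blast
  note [simp] = category_Ide[OF C] category_Ide[OF D] category_Cmp[OF C] category_Cmp[OF D]
    category_Ide_right[OF C] category_Ide_left[OF C] category_Ide_right[OF D] category_Ide_left[OF D]
    Fo Fa Fi
  have "\<exists>G0 t t'. \<forall>Z \<in> Obj C. G0 Z \<in> Obj D \<and> t Z \<in> Arr C Z (F0 (G0 Z)) \<and> t' Z \<in> Arr C (F0 (G0 Z)) Z \<and>
      Cmp C Z (F0 (G0 Z)) Z (t' Z) (t Z) = Ide C Z \<and>
      Cmp C (F0 (G0 Z)) Z (F0 (G0 Z)) (t Z) (t' Z) = Ide C (F0 (G0 Z))"
    using ess_surj unfolding is_iso_def by metis
  then obtain G0 t t' where *: "\<forall>Z \<in> Obj C. G0 Z \<in> Obj D \<and> t Z \<in> Arr C Z (F0 (G0 Z)) \<and> t' Z \<in> Arr C (F0 (G0 Z)) Z \<and>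
      Cmp C Z (F0 (G0 Z)) Z (t' Z) (t Z) = Ide C Z \<and>
      Cmp C (F0 (G0 Z)) Z (F0 (G0 Z)) (t Z) (t' Z) = Ide C (F0 (G0 Z))"
    by (elim exE)
  have [simp]: "G0 Z \<in> Obj D" "t Z \<in> Arr C Z (F0 (G0 Z))" "t' Z \<in> Arr C (F0 (G0 Z)) Z"
    "Cmp C Z (F0 (G0 Z)) Z (t' Z) (t Z) = Ide C Z"
    "Cmp C (F0 (G0 Z)) Z (F0 (G0 Z)) (t Z) (t' Z) = Ide C (F0 (G0 Z))"
    if "Z \<in> Obj C" for Z
    using * that by auto
  \<comment> \<open>The lift depends on the two objects as well as on the arrow, because hom-sets
    may overlap and \<open>F1\<close> takes the objects as arguments.\<close>
  define pre where "pre X Y f = (SOME g. g \<in> Arr D X Y \<and> F1 X Y g = f)" for X Y f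
  have pre: "pre X Y f \<in> Arr D X Y \<and> F1 X Y (pre X Y f) = f"
    if "X \<in> Obj D" "Y \<in> Obj D" "f \<in> Arr C (F0 X) (F0 Y)" for X Y f
  proof -
    have "\<exists>g. g \<in> Arr D X Y \<and> F1 X Y g = f"
      using full[OF that] by blast
    from someI_ex[OF this] show ?thesis
      unfolding pre_def .
  qed
  have pre_arr [simp]: "pre X Y f \<in> Arr D X Y" and F_pre [simp]: "F1 X Y (pre X Y f) = f"
    if "X \<in> Obj D" "Y \<in> Obj D" "f \<in> Arr C (F0 X) (F0 Y)" for X Y f
    using pre[OF that] by blast+
  \<comment> \<open>This is \<open>f\<close> transported along the chosen isomorphisms,
    \<open>t W \<circ> f \<circ> t' Z\<close>. It makes \<open>t\<close> and \<open>t'\<close>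
    natural by construction, as \<open>cj_t\<close> and \<open>t'_cj\<close> record.\<close>
  define cj where "cj Z W f = Cmp C (F0 (G0 Z)) W (F0 (G0 W)) (t W) (Cmp C (F0 (G0 Z)) Z W f (t' Z))"
    for Z W f
  have cj [simp]: "cj Z W f \<in> Arr C (F0 (G0 Z)) (F0 (G0 W))"
    if "Z \<in> Obj C" "W \<in> Obj C" "f \<in> Arr C Z W" for Z W f
    using that category_Cmp[OF C] by (simp add: cj_def)
  have cj_t: "Cmp C Z (F0 (G0 Z)) (F0 (G0 W)) (cj Z W f) (t Z) = Cmp C Z W (F0 (G0 W)) (t W) f"
    if "Z \<in> Obj C" "W \<in> Obj C" "f \<in> Arr C Z W" for Z W f
  proof -
    have "Cmp C Z (F0 (G0 Z)) (F0 (G0 W)) (cj Z W f) (t Z)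
        = Cmp C Z W (F0 (G0 W)) (t W) (Cmp C Z (F0 (G0 Z)) W (Cmp C (F0 (G0 Z)) Z W f (t' Z)) (t Z))"
      unfolding cj_def using that category_Cmp[OF C] by (intro category_assoc[OF C]) auto
    also have "Cmp C Z (F0 (G0 Z)) W (Cmp C (F0 (G0 Z)) Z W f (t' Z)) (t Z) = f"
      using that by (subst category_assoc[OF C]) auto
    finally show ?thesis .
  qed
  have t'_cj: "Cmp C (F0 (G0 Z)) (F0 (G0 W)) W (t' W) (cj Z W f) = Cmp C (F0 (G0 Z)) Z W f (t' Z)"
    if "Z \<in> Obj C" "W \<in> Obj C" "f \<in> Arr C Z W" for Z W f
    unfolding cj_def using that category_Cmp[OF C] by (subst category_assoc[OF C, symmetric]) auto
  define G1 where "G1 Z W f = pre (G0 Z) (G0 W) (cj Z W f)" for Z W f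
  have G1 [simp]: "G1 Z W f \<in> Arr D (G0 Z) (G0 W)" and F_G1 [simp]: "F1 (G0 Z) (G0 W) (G1 Z W f) = cj Z W f"
    if "Z \<in> Obj C" "W \<in> Obj C" "f \<in> Arr C Z W" for Z W f
    using that by (auto simp: G1_def)
  have G: "is_functor C D G0 G1"
    unfolding is_functor_def
  proof (intro conjI ballI)
    fix X assume X: "X \<in> Obj C"
    show "G1 X X (Ide C X) = Ide D (G0 X)"
      by (rule faithful[of "G0 X" "G0 X"]) (use X in \<open>auto simp: cj_def\<close>)
  next
    fix X Y Z f g
    assume *: "X \<in> Obj C" "Y \<in> Obj C" "Z \<in> Obj C" "f \<in> Arr C X Y" "g \<in> Arr C Y Z"
    have gf: "Cmp C X Y Z g f \<in> Arr C X Z"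
      using * category_Cmp[OF C] by blast
    have ft: "Cmp C (F0 (G0 X)) X Y f (t' X) \<in> Arr C (F0 (G0 X)) Y"
      using * category_Cmp[OF C] by simp
    have gt: "Cmp C (F0 (G0 Y)) Y Z g (t' Y) \<in> Arr C (F0 (G0 Y)) Z"
      using * category_Cmp[OF C] by simp
    have "cj X Z (Cmp C X Y Z g f) =
        Cmp C (F0 (G0 X)) (F0 (G0 Y)) (F0 (G0 Z)) (cj Y Z g) (cj X Y f)"
    proof -
      have "Cmp C (F0 (G0 X)) (F0 (G0 Y)) (F0 (G0 Z)) (cj Y Z g) (cj X Y f)
          = Cmp C (F0 (G0 X)) Z (F0 (G0 Z)) (t Z)
             (Cmp C (F0 (G0 X)) (F0 (G0 Y)) Z (Cmp C (F0 (G0 Y)) Y Z g (t' Y)) (cj X Y f))"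
        unfolding cj_def[of Y Z] using * gt by (intro category_assoc[OF C]) auto
      also have "Cmp C (F0 (G0 X)) (F0 (G0 Y)) Z (Cmp C (F0 (G0 Y)) Y Z g (t' Y)) (cj X Y f)
          = Cmp C (F0 (G0 X)) Y Z g (Cmp C (F0 (G0 X)) X Y f (t' X))"
        using * by (subst category_assoc[OF C]) (auto simp: t'_cj)
      also have "\<dots> = Cmp C (F0 (G0 X)) X Z (Cmp C X Y Z g f) (t' X)"
        using * by (intro category_assoc[OF C, symmetric]) auto
      finally show ?thesis
        by (simp add: cj_def)
    qed
    then show "G1 X Z (Cmp C X Y Z g f) = Cmp D (G0 X) (G0 Y) (G0 Z) (G1 Y Z g) (G1 X Y f)"
      using * gf category_Cmp[OF D] Fc by (intro faithful[of "G0 X" "G0 Z"]) (auto simp: Fc[of "G0 X" "G0 Y" "G0 Z"])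
  qed auto
  have eta: "natural_iso C C (\<lambda>X. X) (\<lambda>X Y f. f)
      (\<lambda>X. F0 (G0 X)) (\<lambda>X Y f. F1 (G0 X) (G0 Y) (G1 X Y f)) t"
    unfolding natural_iso_def is_iso_def
  proof (intro conjI ballI)
    fix X assume "X \<in> Obj C"
    then show "t X \<in> Arr C X (F0 (G0 X))"
      "\<exists>g\<in>Arr C (F0 (G0 X)) X. Cmp C X (F0 (G0 X)) X g (t X) = Ide C X \<and>
         Cmp C (F0 (G0 X)) X (F0 (G0 X)) (t X) g = Ide C (F0 (G0 X))"
      by (auto intro!: bexI[of _ "t' X"])
  qed (auto simp: cj_t)
  \<comment> \<open>The counit at \<open>X\<close> must become \<open>t' (F0 X)\<close> under
    \<open>F1\<close>; its naturality is then \<open>t'_cj\<close>, and its inverse is the lift of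
    \<open>t (F0 X)\<close>.\<close>
  define ep where "ep X = pre (G0 (F0 X)) X (t' (F0 X))" for X
  have ep [simp]: "ep X \<in> Arr D (G0 (F0 X)) X" and F_ep [simp]: "F1 (G0 (F0 X)) X (ep X) = t' (F0 X)"
    if "X \<in> Obj D" for X
    using that by (auto simp: ep_def)
  have eps: "natural_iso D D (\<lambda>X. G0 (F0 X)) (\<lambda>X Y f. G1 (F0 X) (F0 Y) (F1 X Y f)) (\<lambda>X. X) (\<lambda>X Y f. f) ep"
    unfolding natural_iso_def is_iso_def
  proof (intro conjI ballI)
    fix X assume X: "X \<in> Obj D"
    then show "ep X \<in> Arr D (G0 (F0 X)) X"
      by simp
    show "\<exists>g\<in>Arr D X (G0 (F0 X)). Cmp D (G0 (F0 X)) X (G0 (F0 X)) g (ep X) = Ide D (G0 (F0 X)) \<and>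
            Cmp D X (G0 (F0 X)) X (ep X) g = Ide D X"
    proof (intro bexI[of _ "pre X (G0 (F0 X)) (t (F0 X))"] conjI)
      show "Cmp D (G0 (F0 X)) X (G0 (F0 X)) (pre X (G0 (F0 X)) (t (F0 X))) (ep X) = Ide D (G0 (F0 X))"
        by (rule faithful[of "G0 (F0 X)" "G0 (F0 X)"])
          (use X category_Cmp[OF D] in \<open>auto simp: Fc[of _ X]\<close>)
      show "Cmp D X (G0 (F0 X)) X (ep X) (pre X (G0 (F0 X)) (t (F0 X))) = Ide D X"
        by (rule faithful[of X X])
          (use X category_Cmp[OF D] in \<open>auto simp: Fc[of _ "G0 (F0 X)"]\<close>)
    qed (use X in auto)
  next
    fix X Y f assume *: "X \<in> Obj D" "Y \<in> Obj D" "f \<in> Arr D X Y"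
    show "Cmp D (G0 (F0 X)) (G0 (F0 Y)) Y (ep Y) (G1 (F0 X) (F0 Y) (F1 X Y f)) =
       Cmp D (G0 (F0 X)) X Y f (ep X)"
      by (rule faithful[of "G0 (F0 X)" Y])
        (use * category_Cmp[OF D] in \<open>auto simp: Fc[of "G0 (F0 X)" "G0 (F0 Y)" Y] Fc[of "G0 (F0 X)" X Y] t'_cj\<close>)
  qed
  show ?thesis
    unfolding equivalent_categories_def using C D F G eta eps by blast
qed


section \<open>Embeddings modulo automorphisms\<close>

lemma embeddings_funcset: "f \<in> embeddings \<Sigma> A B \<Longrightarrow> f \<in> univ A \<rightarrow> univ B"
  by (auto simp: embeddings_def)

lemma embeddings_extensional: "f \<in> embeddings \<Sigma> A B \<Longrightarrow> f \<in> extensional (univ A)"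
  by (auto simp: embeddings_def PiE_def)

lemma embeddings_inj_on: "f \<in> embeddings \<Sigma> A B \<Longrightarrow> inj_on f (univ A)"
  by (simp add: embeddings_def)

lemma embeddings_apply: "\<lbrakk>f \<in> embeddings \<Sigma> A B; x \<in> univ A\<rbrakk> \<Longrightarrow> f x \<in> univ B"
  by (auto simp: embeddings_def)

lemma embeddings_rel_iff:
  "\<lbrakk>f \<in> embeddings \<Sigma> A B; r \<in> syms \<Sigma>; xs \<in> tuples \<Sigma> r (univ A)\<rbrakk>
    \<Longrightarrow> map f xs \<in> rel B r \<longleftrightarrow> xs \<in> rel A r"
  by (simp add: embeddings_def)

lemma map_in_tuples: "\<lbrakk>f \<in> X \<rightarrow> Y; xs \<in> tuples \<Sigma> r X\<rbrakk> \<Longrightarrow> map f xs \<in> tuples \<Sigma> r Y"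
  by (auto simp: tuples_def)

lemma embeddings_eqI:
  "\<lbrakk>f \<in> embeddings \<Sigma> A B; g \<in> embeddings \<Sigma> A B; \<And>x. x \<in> univ A \<Longrightarrow> f x = g x\<rbrakk> \<Longrightarrow> f = g"
  by (rule extensionalityI[OF embeddings_extensional embeddings_extensional])

lemma embeddings_compose:
  assumes f: "f \<in> embeddings \<Sigma> A B" and g: "g \<in> embeddings \<Sigma> B C"
  shows "compose (univ A) g f \<in> embeddings \<Sigma> A C"
proof -
  have "inj_on (compose (univ A) g f) (univ A)"
    using embeddings_inj_on[OF f] embeddings_inj_on[OF g] embeddings_apply[OF f]
    by (auto simp: inj_on_def compose_eq)
  moreover have "map (compose (univ A) g f) xs \<in> rel C r \<longleftrightarrow> xs \<in> rel A r"
    if "r \<in> syms \<Sigma>" "xs \<in> tuples \<Sigma> r (univ A)" for r xs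
  proof -
    have eq: "map (compose (univ A) g f) xs = map g (map f xs)"
      using that by (auto simp: compose_def tuples_def)
    show ?thesis
      unfolding eq using embeddings_rel_iff[OF f that]
        embeddings_rel_iff[OF g that(1) map_in_tuples[OF embeddings_funcset[OF f] that(2)]] by blast
  qed
  ultimately show ?thesis
    using embeddings_apply[OF f] embeddings_apply[OF g] by (auto simp: embeddings_def compose_def)
qed

lemma embeddings_compose_assoc:
  "f \<in> embeddings \<Sigma> A B
    \<Longrightarrow> compose (univ A) (compose (univ B) h g) f = compose (univ A) h (compose (univ A) g f)"
  by (rule compose_assoc[OF embeddings_funcset, symmetric])

lemma embeddings_id: "(\<lambda>x \<in> univ A. x) \<in> embeddings \<Sigma> A A"
proof -
  have "map (\<lambda>x \<in> univ A. x) xs = xs" if "set xs \<subseteq> univ A" for xs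
    using that by (intro map_idI) auto
  then show ?thesis
    by (auto simp: embeddings_def tuples_def inj_on_def)
qed

lemma embeddings_compose_id:
  "f \<in> embeddings \<Sigma> A B \<Longrightarrow> compose (univ A) f (\<lambda>x \<in> univ A. x) = f"
  "f \<in> embeddings \<Sigma> A B \<Longrightarrow> compose (univ A) (\<lambda>x \<in> univ B. x) f = f"
  by (metis compose_Id embeddings_funcset embeddings_extensional)
    (metis Id_compose embeddings_funcset embeddings_extensional)

lemma embeddings_cancel:
  assumes e: "e \<in> embeddings \<Sigma> A U" and u: "u \<in> embeddings \<Sigma> B A" and v: "v \<in> embeddings \<Sigma> B A"
    and eq: "compose (univ B) e u = compose (univ B) e v"
  shows "u = v"
proof (rule embeddings_eqI[OF u v])
  fix x assume x: "x \<in> univ B"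
  then have "e (u x) = e (v x)"
    using fun_cong[OF eq, of x] by (simp add: compose_eq)
  then show "u x = v x"
    using embeddings_inj_on[OF e] embeddings_apply[OF u x] embeddings_apply[OF v x]
    by (auto dest: inj_onD)
qed

text \<open>The map \<open>u\<close> is forced to be the inverse of \<open>e\<close> applied after
  \<open>e'\<close>. Since \<open>e\<close> and \<open>e'\<close> both preserve and reflect
  relations and \<open>e \<circ> u = e'\<close>, so does \<open>u\<close>. This turns an inclusion
  of images, which supports can detect, into a morphism.\<close>

lemma embeddings_factor:
  assumes e: "e \<in> embeddings \<Sigma> A U" and e': "e' \<in> embeddings \<Sigma> B U"
    and sub: "e' ` univ B \<subseteq> e ` univ A"
  obtains u where "u \<in> embeddings \<Sigma> B A" "compose (univ B) e u = e'"
proof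
  define u where "u = (\<lambda>x \<in> univ B. inv_into (univ A) e (e' x))"
  have u: "u x \<in> univ A" "e (u x) = e' x" if "x \<in> univ B" for x
    using that sub by (auto simp: u_def image_subset_iff inv_into_into f_inv_into_f)
  have "inj_on u (univ B)"
    using u embeddings_inj_on[OF e'] by (metis inj_onD inj_onI)
  moreover have "map u xs \<in> rel A r \<longleftrightarrow> xs \<in> rel B r"
    if "r \<in> syms \<Sigma>" "xs \<in> tuples \<Sigma> r (univ B)" for r xs
  proof -
    have eq: "map e' xs = map e (map u xs)"
      using that u by (auto simp: tuples_def)
    have "map u xs \<in> tuples \<Sigma> r (univ A)"
      using that u by (auto simp: tuples_def)
    then show ?thesis
      using embeddings_rel_iff[OF e' that] embeddings_rel_iff[OF e that(1)] unfolding eq by blast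
  qed
  ultimately show "u \<in> embeddings \<Sigma> B A"
    using u by (auto simp: embeddings_def u_def)
  show "compose (univ B) e u = e'"
    using u embeddings_extensional[OF e'] by (intro extensionalityI[of _ "univ B"]) (auto simp: compose_eq)
qed

lemma isomorphisms_embeddings: "f \<in> isomorphisms \<Sigma> A B \<Longrightarrow> f \<in> embeddings \<Sigma> A B"
  by (simp add: isomorphisms_def)

lemma isomorphisms_image: "f \<in> isomorphisms \<Sigma> A B \<Longrightarrow> f ` univ A = univ B"
  by (simp add: isomorphisms_def)

lemma isomorphisms_id: "(\<lambda>x \<in> univ A. x) \<in> isomorphisms \<Sigma> A A"
  by (auto simp: isomorphisms_def embeddings_id)

lemma isomorphisms_compose:
  "\<lbrakk>f \<in> isomorphisms \<Sigma> A B; g \<in> isomorphisms \<Sigma> B C\<rbrakk> \<Longrightarrow> compose (univ A) g f \<in> isomorphisms \<Sigma> A C"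
  by (auto simp: isomorphisms_def embeddings_compose surj_compose[of f "univ A" "univ B" g "univ C"])

text \<open>Factoring the identity of \<open>B\<close> through \<open>f\<close> gives a right
  inverse; it is also a left inverse because embeddings are left cancellable.\<close>

lemma isomorphisms_inverse:
  assumes f: "f \<in> isomorphisms \<Sigma> A B"
  obtains g where "g \<in> isomorphisms \<Sigma> B A" "compose (univ B) f g = (\<lambda>x \<in> univ B. x)"
    "compose (univ A) g f = (\<lambda>x \<in> univ A. x)"
proof -
  note fe = isomorphisms_embeddings[OF f]
  obtain g where g: "g \<in> embeddings \<Sigma> B A" and fg: "compose (univ B) f g = (\<lambda>x \<in> univ B. x)"
    using embeddings_factor[OF fe embeddings_id[of B]] isomorphisms_image[OF f] by auto
  have "compose (univ A) f (compose (univ A) g f) = compose (univ A) f (\<lambda>x \<in> univ A. x)"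
    using embeddings_compose_assoc[OF fe, of f g] by (simp add: fg embeddings_compose_id[OF fe])
  then have gf: "compose (univ A) g f = (\<lambda>x \<in> univ A. x)"
    using embeddings_cancel[OF fe] embeddings_compose[OF fe g] embeddings_id by blast
  have "g ` univ B = univ A"
  proof
    show "g ` univ B \<subseteq> univ A"
      using embeddings_apply[OF g] by blast
    show "univ A \<subseteq> g ` univ B"
    proof
      fix x assume x: "x \<in> univ A"
      then have "g (f x) = x"
        using fun_cong[OF gf, of x] by (simp add: compose_eq)
      then show "x \<in> g ` univ B"
        using embeddings_apply[OF fe x] by (metis imageI)
    qed
  qed
  then show thesis
    using that g fg gf by (simp add: isomorphisms_def)
qed

text \<open>Applied to \<open>e' = \<pi> \<circ> e\<close>, this converts an automorphism
  \<open>\<pi>\<close> of the limit that preserves the image of \<open>e\<close> into an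
  automorphism of the small structure.\<close>

lemma isomorphisms_factor:
  assumes e: "e \<in> embeddings \<Sigma> A U" and e': "e' \<in> embeddings \<Sigma> B U"
    and im: "e' ` univ B = e ` univ A"
  obtains u where "u \<in> isomorphisms \<Sigma> B A" "compose (univ B) e u = e'"
proof -
  obtain u where u: "u \<in> embeddings \<Sigma> B A" and eu: "compose (univ B) e u = e'"
    using embeddings_factor[OF e e'] im by blast
  have "y \<in> u ` univ B" if y: "y \<in> univ A" for y
  proof -
    obtain x where x: "x \<in> univ B" "e y = e' x"
      using im y by (metis imageE imageI)
    then have "e y = e (u x)"
      using eu by (metis compose_eq)
    then have "y = u x"
      using embeddings_inj_on[OF e] y embeddings_apply[OF u x(1)] by (auto dest: inj_onD)
    then show ?thesis
      using x by blast
  qed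
  then have "u ` univ B = univ A"
    using embeddings_apply[OF u] by blast
  then show thesis
    using that u eu by (simp add: isomorphisms_def)
qed

text \<open>This allows embeddings into finite substructures to be treated throughout as embeddings
  into \<open>U\<close> with a controlled image.\<close>

lemma embeddings_induced_iff:
  "X \<subseteq> univ U \<Longrightarrow> e \<in> embeddings \<Sigma> A (induced U X) \<longleftrightarrow> e \<in> embeddings \<Sigma> A U \<and> e ` univ A \<subseteq> X"
  unfolding embeddings_def induced_def tuples_def
  by (auto simp: PiE_iff image_subset_iff subset_iff)

section \<open>Automorphism groups and classes of embeddings modulo a subgroup\<close>

lemma group_aut_group: "group (aut_group \<Sigma> A)"
proof (rule groupI)
  fix f g h
  assume "f \<in> carrier (aut_group \<Sigma> A)" "g \<in> carrier (aut_group \<Sigma> A)" "h \<in> carrier (aut_group \<Sigma> A)"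
  then show "f \<otimes>\<^bsub>aut_group \<Sigma> A\<^esub> g \<otimes>\<^bsub>aut_group \<Sigma> A\<^esub> h = f \<otimes>\<^bsub>aut_group \<Sigma> A\<^esub> (g \<otimes>\<^bsub>aut_group \<Sigma> A\<^esub> h)"
    by (simp add: aut_group_def embeddings_compose_assoc[OF isomorphisms_embeddings])
next
  fix f assume "f \<in> carrier (aut_group \<Sigma> A)"
  then show "\<exists>g \<in> carrier (aut_group \<Sigma> A). g \<otimes>\<^bsub>aut_group \<Sigma> A\<^esub> f = \<one>\<^bsub>aut_group \<Sigma> A\<^esub>"
    unfolding aut_group_def by simp (metis isomorphisms_inverse)
qed (auto simp: aut_group_def isomorphisms_compose isomorphisms_id embeddings_compose_id[OF isomorphisms_embeddings])

lemma aut_group_simps [simp]: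
  "carrier (aut_group \<Sigma> A) = isomorphisms \<Sigma> A A"
  "mult (aut_group \<Sigma> A) \<pi> \<sigma> = compose (univ A) \<sigma> \<pi>"
  "one (aut_group \<Sigma> A) = (\<lambda>x \<in> univ A. x)"
  by (simp_all add: aut_group_def)

context
  fixes \<Sigma> :: "'r signature" and A :: "('a, 'r) relstruct" and S
  assumes S: "subgroup S (aut_group \<Sigma> A)"
begin

lemma aut_subgroup_isomorphisms: "\<sigma> \<in> S \<Longrightarrow> \<sigma> \<in> isomorphisms \<Sigma> A A"
  using subgroup.subset[OF S] by auto

lemma aut_subgroup_embeddings: "\<sigma> \<in> S \<Longrightarrow> \<sigma> \<in> embeddings \<Sigma> A A"
  by (intro isomorphisms_embeddings aut_subgroup_isomorphisms)

lemma aut_subgroup_id: "(\<lambda>x \<in> univ A. x) \<in> S"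
  using subgroup.one_closed[OF S] by simp

lemma aut_subgroup_compose: "\<lbrakk>\<sigma> \<in> S; \<tau> \<in> S\<rbrakk> \<Longrightarrow> compose (univ A) \<sigma> \<tau> \<in> S"
  using subgroup.m_closed[OF S, of \<tau> \<sigma>] by simp

lemma aut_subgroup_inverse:
  assumes "\<sigma> \<in> S"
  obtains \<tau> where "\<tau> \<in> S" "compose (univ A) \<sigma> \<tau> = (\<lambda>x \<in> univ A. x)"
    "compose (univ A) \<tau> \<sigma> = (\<lambda>x \<in> univ A. x)"
  using subgroup.m_inv_closed[OF S assms] assms group.l_inv[OF group_aut_group, of \<sigma> \<Sigma> A]
    group.r_inv[OF group_aut_group, of \<sigma> \<Sigma> A] aut_subgroup_isomorphisms by simp

end

text \<open>Unlike in \<^const>\<open>emb_equiv\<close>, the codomain of the embedding may live on another type, so that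
  the same classes serve for the morphisms (codomain in \<open>K\<close>) and for the points of orbits
  (codomain \<open>U\<close>).\<close>

definition eclass :: "('b, 'r) relstruct \<Rightarrow> ('b \<Rightarrow> 'b) set \<Rightarrow> ('b \<Rightarrow> 'c) \<Rightarrow> ('b \<Rightarrow> 'c) set" where
  "eclass B T u = compose (univ B) u ` T"

context
  fixes \<Sigma> :: "'r signature" and B :: "('b, 'r) relstruct" and T
  assumes T: "subgroup T (aut_group \<Sigma> B)"
begin

lemma eclass_embeddings: "\<lbrakk>u \<in> embeddings \<Sigma> B A; v \<in> eclass B T u\<rbrakk> \<Longrightarrow> v \<in> embeddings \<Sigma> B A"
  using embeddings_compose aut_subgroup_embeddings[OF T] by (fastforce simp: eclass_def)

lemma eclass_self: "u \<in> embeddings \<Sigma> B A \<Longrightarrow> u \<in> eclass B T u"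
  unfolding eclass_def
  by (rule image_eqI[OF _ aut_subgroup_id[OF T]]) (simp add: embeddings_compose_id)

text \<open>The class of \<open>u\<close> is the coset \<open>u T\<close>, and
  \<open>\<tau> T = T\<close>: closure under composition gives one inclusion, the inverse of
  \<open>\<tau>\<close> the other.\<close>

lemma eclass_compose:
  assumes u: "u \<in> embeddings \<Sigma> B A" and \<tau>: "\<tau> \<in> T"
  shows "eclass B T (compose (univ B) u \<tau>) = eclass B T u"
proof -
  obtain \<tau>' where \<tau>': "\<tau>' \<in> T" "compose (univ B) \<tau> \<tau>' = (\<lambda>x \<in> univ B. x)"
    using aut_subgroup_inverse[OF T \<tau>] .
  note assoc = embeddings_compose_assoc[OF aut_subgroup_embeddings[OF T]]
  show ?thesis
  proof
    show "eclass B T (compose (univ B) u \<tau>) \<subseteq> eclass B T u"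
      using aut_subgroup_compose[OF T \<tau>] by (auto simp: eclass_def assoc)
    show "eclass B T u \<subseteq> eclass B T (compose (univ B) u \<tau>)"
    proof
      fix v assume "v \<in> eclass B T u"
      then obtain \<rho> where \<rho>: "\<rho> \<in> T" "v = compose (univ B) u \<rho>"
        by (auto simp: eclass_def)
      have "compose (univ B) (compose (univ B) u \<tau>) (compose (univ B) \<tau>' \<rho>) = v"
        using \<rho> \<tau>' aut_subgroup_compose[OF T \<tau>'(1) \<rho>(1)]
        by (simp add: assoc) (simp add: assoc[symmetric] embeddings_compose_id(2)[OF aut_subgroup_embeddings[OF T]])
      then show "v \<in> eclass B T (compose (univ B) u \<tau>)"
        using aut_subgroup_compose[OF T \<tau>'(1) \<rho>(1)] by (auto simp: eclass_def)
    qed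
  qed
qed

lemma eclass_eq_iff:
  assumes "u \<in> embeddings \<Sigma> B A" "v \<in> embeddings \<Sigma> B A"
  shows "eclass B T u = eclass B T v \<longleftrightarrow> (\<exists>\<tau> \<in> T. v = compose (univ B) u \<tau>)"
  using assms eclass_self[of v A] eclass_compose[of u A] by (auto simp: eclass_def)

lemma emb_equiv_Image: "u \<in> embeddings \<Sigma> B A \<Longrightarrow> emb_equiv \<Sigma> B A T `` {u} = eclass B T u"
  using eclass_embeddings by (auto simp: emb_equiv_def eclass_def)

end

lemma eclass_compose_left:
  assumes "subgroup T (aut_group \<Sigma> B)" "u \<in> embeddings \<Sigma> B A" "v \<in> embeddings \<Sigma> B A"
    and "e \<in> embeddings \<Sigma> A C" "eclass B T u = eclass B T v"
  shows "eclass B T (compose (univ B) e u) = eclass B T (compose (univ B) e v)"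
proof -
  obtain \<tau> where \<tau>: "\<tau> \<in> T" "v = compose (univ B) u \<tau>"
    using assms eclass_eq_iff by metis
  then have "compose (univ B) e v = compose (univ B) (compose (univ B) e u) \<tau>"
    using embeddings_compose_assoc[OF aut_subgroup_embeddings[OF assms(1)]] by metis
  then show ?thesis
    using \<tau> eclass_compose[OF assms(1)] embeddings_compose[OF assms(2,4)] by metis
qed

text \<open>This is the purpose of admissibility: a change of representative by
  \<open>\<sigma>\<close> in \<open>S\<close> is pushed across \<open>u\<close>, since
  \<open>e \<circ> \<sigma> \<circ> u = e \<circ> u \<circ> \<tau>\<close>. Postcomposition, by
  contrast, respects classes for every embedding.\<close>

lemma eclass_compose_right:
  assumes S: "subgroup S (aut_group \<Sigma> A)" and T: "subgroup T (aut_group \<Sigma> B)"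
    and u: "u \<in> admissible_embeddings \<Sigma> (A, S) (B, T)"
    and e: "e \<in> embeddings \<Sigma> A C" "e' \<in> embeddings \<Sigma> A C" "eclass A S e = eclass A S e'"
  shows "eclass B T (compose (univ B) e u) = eclass B T (compose (univ B) e' u)"
proof -
  obtain \<sigma> where \<sigma>: "\<sigma> \<in> S" "e' = compose (univ A) e \<sigma>"
    using e eclass_eq_iff[OF S] by metis
  have ue: "u \<in> embeddings \<Sigma> B A"
    using u by (simp add: admissible_embeddings_def)
  obtain \<tau> where \<tau>: "\<tau> \<in> T" "compose (univ B) \<sigma> u = compose (univ B) u \<tau>"
    using u \<sigma> by (auto simp: admissible_embeddings_def)
  have "compose (univ B) e' u = compose (univ B) (compose (univ B) e u) \<tau>"
    using \<sigma> \<tau> embeddings_compose_assoc[OF ue, of e \<sigma>]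
      embeddings_compose_assoc[OF aut_subgroup_embeddings[OF T], of \<tau> e u] by simp
  then show ?thesis
    using \<tau> eclass_compose[OF T] embeddings_compose[OF ue e(1)] by metis
qed

lemma admissible_embeddings_embeddings:
  "u \<in> admissible_embeddings \<Sigma> (A, S) (B, T) \<Longrightarrow> u \<in> embeddings \<Sigma> B A"
  by (simp add: admissible_embeddings_def)

lemma admissible_embeddings_id:
  assumes "subgroup S (aut_group \<Sigma> A)"
  shows "(\<lambda>x \<in> univ A. x) \<in> admissible_embeddings \<Sigma> (A, S) (A, S)"
proof -
  have "\<exists>\<tau> \<in> S. compose (univ A) \<sigma> (\<lambda>x \<in> univ A. x) = compose (univ A) (\<lambda>x \<in> univ A. x) \<tau>"
    if "\<sigma> \<in> S" for \<sigma>
    using that embeddings_compose_id[OF aut_subgroup_embeddings[OF assms that]] by metis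
  then show ?thesis
    by (simp add: admissible_embeddings_def embeddings_id)
qed

text \<open>Push \<open>\<sigma>\<close> across \<open>u\<close> to obtain some
  \<open>\<tau>\<close> in \<open>T\<close>, then push \<open>\<tau>\<close> across \<open>v\<close>
  to obtain some \<open>\<rho>\<close> in \<open>R\<close>.\<close>

lemma admissible_embeddings_compose:
  assumes T: "subgroup T (aut_group \<Sigma> B)" and R: "subgroup R (aut_group \<Sigma> C)"
    and u: "u \<in> admissible_embeddings \<Sigma> (A, S) (B, T)" and v: "v \<in> admissible_embeddings \<Sigma> (B, T) (C, R)"
  shows "compose (univ C) u v \<in> admissible_embeddings \<Sigma> (A, S) (C, R)"
proof -
  note ue = admissible_embeddings_embeddings[OF u] and ve = admissible_embeddings_embeddings[OF v]
  have "\<exists>\<rho> \<in> R. compose (univ C) \<sigma> (compose (univ C) u v) = compose (univ C) (compose (univ C) u v) \<rho>"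
    if \<sigma>: "\<sigma> \<in> S" for \<sigma>
  proof -
    obtain \<tau> where \<tau>: "\<tau> \<in> T" "compose (univ B) \<sigma> u = compose (univ B) u \<tau>"
      using u \<sigma> by (auto simp: admissible_embeddings_def)
    obtain \<rho> where \<rho>: "\<rho> \<in> R" "compose (univ C) \<tau> v = compose (univ C) v \<rho>"
      using v \<tau> by (auto simp: admissible_embeddings_def)
    have "compose (univ C) \<sigma> (compose (univ C) u v) = compose (univ C) (compose (univ B) u \<tau>) v"
      using embeddings_compose_assoc[OF ve, of \<sigma> u] \<tau> by simp
    also have "\<dots> = compose (univ C) u (compose (univ C) v \<rho>)"
      using embeddings_compose_assoc[OF ve, of u \<tau>] \<rho> by simp
    also have "\<dots> = compose (univ C) (compose (univ C) u v) \<rho>"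
      using embeddings_compose_assoc[OF aut_subgroup_embeddings[OF R \<rho>(1)]] by metis
    finally show ?thesis
      using \<rho> by blast
  qed
  then show ?thesis
    using embeddings_compose[OF ve ue] by (simp add: admissible_embeddings_def)
qed

section \<open>The category of structures with subgroups\<close>

lemma structure_subgroup_cat_Obj:
  "P \<in> Obj (structure_subgroup_cat \<Sigma> K) \<longleftrightarrow> (\<exists>A S. P = (A, S) \<and> A \<in> K \<and> subgroup S (aut_group \<Sigma> A))"
  by (auto simp: structure_subgroup_cat_def)

text \<open>From here on a morphism is handled through one admissible representative; the other
  members of its class are reached by equality of classes.\<close>

lemma structure_subgroup_cat_Arr:
  assumes "subgroup T (aut_group \<Sigma> B)"
  shows "Arr (structure_subgroup_cat \<Sigma> K) (A, S) (B, T) = eclass B T ` admissible_embeddings \<Sigma> (A, S) (B, T)"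
  using emb_equiv_Image[OF assms, of _ A]
  by (auto simp: structure_subgroup_cat_def quotient_def admissible_embeddings_def image_iff)

lemma structure_subgroup_cat_Ide:
  "subgroup S (aut_group \<Sigma> A)
    \<Longrightarrow> Ide (structure_subgroup_cat \<Sigma> K) (A, S) = eclass A S (\<lambda>x \<in> univ A. x)"
  by (simp add: structure_subgroup_cat_def emb_equiv_Image embeddings_id)

text \<open>All terms of the defining union are the same class: \<open>v'\<close> is replaced by
  \<open>v\<close> with \<open>u'\<close> held fixed on the left, and then \<open>u'\<close> by
  \<open>u\<close> using that \<open>v\<close> is admissible. The union collapses because both index
  classes contain their representative and so are nonempty.\<close>

lemma structure_subgroup_cat_Cmp:
  assumes T: "subgroup T (aut_group \<Sigma> B)" and R: "subgroup R (aut_group \<Sigma> C)"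
    and u: "u \<in> embeddings \<Sigma> B A" and v: "v \<in> admissible_embeddings \<Sigma> (B, T) (C, R)"
  shows "Cmp (structure_subgroup_cat \<Sigma> K) (A, S) (B, T) (C, R) (eclass C R v) (eclass B T u)
    = eclass C R (compose (univ C) u v)"
proof -
  note ve = admissible_embeddings_embeddings[OF v]
  have *: "emb_equiv \<Sigma> C A R `` {compose (univ C) u' v'} = eclass C R (compose (univ C) u v)"
    if u': "u' \<in> eclass B T u" and v': "v' \<in> eclass C R v" for u' v'
  proof -
    have e: "u' \<in> embeddings \<Sigma> B A" "v' \<in> embeddings \<Sigma> C B"
      using eclass_embeddings[OF T u u'] eclass_embeddings[OF R ve v'] by auto
    obtain \<tau> \<rho> where "\<tau> \<in> T" "u' = compose (univ B) u \<tau>" "\<rho> \<in> R" "v' = compose (univ C) v \<rho>"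
      using u' v' by (auto simp: eclass_def)
    then have "eclass B T u = eclass B T u'" "eclass C R v' = eclass C R v"
      using eclass_compose[OF T u] eclass_compose[OF R ve] by auto
    then have "eclass C R (compose (univ C) u' v') = eclass C R (compose (univ C) u v)"
      using eclass_compose_left[OF R e(2) ve e(1)] eclass_compose_right[OF T R v u e(1)] by simp
    then show ?thesis
      using emb_equiv_Image[OF R] embeddings_compose[OF e(2,1)] by simp
  qed
  have "Cmp (structure_subgroup_cat \<Sigma> K) (A, S) (B, T) (C, R) (eclass C R v) (eclass B T u) =
      (\<Union>u' \<in> eclass B T u. \<Union>v' \<in> eclass C R v. eclass C R (compose (univ C) u v))"
    unfolding structure_subgroup_cat_def using * by simp
  then show ?thesis
    using eclass_self[OF T u] eclass_self[OF R ve] by blast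
qed

lemma is_category_structure_subgroup_cat: "is_category (structure_subgroup_cat \<Sigma> K)"
  (is "is_category ?C")
  unfolding is_category_def
proof (intro conjI ballI)
  fix P assume "P \<in> Obj ?C"
  then show "Ide ?C P \<in> Arr ?C P P"
    by (auto simp: structure_subgroup_cat_Obj structure_subgroup_cat_Ide structure_subgroup_cat_Arr
        intro!: admissible_embeddings_id)
next
  fix P Q R f g
  assume "P \<in> Obj ?C" "Q \<in> Obj ?C" "R \<in> Obj ?C" "f \<in> Arr ?C P Q" "g \<in> Arr ?C Q R"
  then show "Cmp ?C P Q R g f \<in> Arr ?C P R"
    by (auto simp: structure_subgroup_cat_Obj structure_subgroup_cat_Arr structure_subgroup_cat_Cmp
        admissible_embeddings_embeddings intro!: imageI admissible_embeddings_compose)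
next
  fix P Q f
  assume "P \<in> Obj ?C" "Q \<in> Obj ?C" "f \<in> Arr ?C P Q"
  then show "Cmp ?C P P Q f (Ide ?C P) = f" "Cmp ?C P Q Q (Ide ?C Q) f = f"
    by (auto simp: structure_subgroup_cat_Obj structure_subgroup_cat_Arr structure_subgroup_cat_Cmp
        structure_subgroup_cat_Ide admissible_embeddings_embeddings admissible_embeddings_id
        embeddings_id embeddings_compose_id[OF admissible_embeddings_embeddings])
next
  fix N P Q R f g h
  assume "N \<in> Obj ?C" "P \<in> Obj ?C" "Q \<in> Obj ?C" "R \<in> Obj ?C"
    "f \<in> Arr ?C N P" "g \<in> Arr ?C P Q" "h \<in> Arr ?C Q R"
  then obtain A S B T C V D W u v w where
    "N = (A, S)" "P = (B, T)" "Q = (C, V)" "R = (D, W)"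
    and sub: "subgroup T (aut_group \<Sigma> B)" "subgroup V (aut_group \<Sigma> C)" "subgroup W (aut_group \<Sigma> D)"
    and f: "f = eclass B T u" "u \<in> admissible_embeddings \<Sigma> (A, S) (B, T)"
    and g: "g = eclass C V v" "v \<in> admissible_embeddings \<Sigma> (B, T) (C, V)"
    and h: "h = eclass D W w" "w \<in> admissible_embeddings \<Sigma> (C, V) (D, W)"
    by (auto simp: structure_subgroup_cat_Obj structure_subgroup_cat_Arr)
  moreover note uvw = f(2) g(2) h(2)
  note emb = uvw[THEN admissible_embeddings_embeddings]
  ultimately show "Cmp ?C N P R (Cmp ?C P Q R h g) f = Cmp ?C N Q R h (Cmp ?C N P Q g f)"
    using structure_subgroup_cat_Cmp[OF sub(1,3) emb(1) admissible_embeddings_compose[OF sub(2,3) uvw(2,3)]]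
      structure_subgroup_cat_Cmp[OF sub(2,3) embeddings_compose[OF emb(2,1)] uvw(3)]
    by (simp add: structure_subgroup_cat_Cmp emb embeddings_compose_assoc[OF emb(3)])
qed


section \<open>The orbit of embeddings into the limit\<close>

lemma gact_closed: "\<lbrakk>is_gset G X; x \<in> gcarrier X; \<pi> \<in> carrier G\<rbrakk> \<Longrightarrow> gact X x \<pi> \<in> gcarrier X"
  by (auto simp: is_gset_def dest!: PiE_mem)

lemma gact_one: "\<lbrakk>is_gset G X; x \<in> gcarrier X\<rbrakk> \<Longrightarrow> gact X x \<one>\<^bsub>G\<^esub> = x"
  by (simp add: is_gset_def)

lemma gact_mult:
  "\<lbrakk>is_gset G X; x \<in> gcarrier X; \<pi> \<in> carrier G; \<sigma> \<in> carrier G\<rbrakk>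
    \<Longrightarrow> gact X x (\<pi> \<otimes>\<^bsub>G\<^esub> \<sigma>) = gact X (gact X x \<pi>) \<sigma>"
  by (simp add: is_gset_def)

lemma equivariant_maps_PiE: "f \<in> equivariant_maps G X Y \<Longrightarrow> f \<in> gcarrier X \<rightarrow>\<^sub>E gcarrier Y"
  by (simp add: equivariant_maps_def)

lemma equivariant_maps_apply: "\<lbrakk>f \<in> equivariant_maps G X Y; x \<in> gcarrier X\<rbrakk> \<Longrightarrow> f x \<in> gcarrier Y"
  by (auto simp: equivariant_maps_def)

lemma equivariant_maps_gact:
  "\<lbrakk>f \<in> equivariant_maps G X Y; x \<in> gcarrier X; \<pi> \<in> carrier G\<rbrakk> \<Longrightarrow> f (gact X x \<pi>) = gact Y (f x) \<pi>"
  by (simp add: equivariant_maps_def)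

lemma equivariant_maps_eqI:
  assumes "f \<in> equivariant_maps G X Y" "g \<in> equivariant_maps G X Y" "\<And>x. x \<in> gcarrier X \<Longrightarrow> f x = g x"
  shows "f = g"
  using assms by (intro PiE_ext[OF equivariant_maps_PiE equivariant_maps_PiE])

lemma single_orbit_nominal_cat_simps [simp]:
  "X \<in> Obj (single_orbit_nominal_cat D G) \<longleftrightarrow> nominal D G X \<and> single_orbit G X"
  "Arr (single_orbit_nominal_cat D G) = equivariant_maps G"
  "Ide (single_orbit_nominal_cat D G) X = (\<lambda>x \<in> gcarrier X. x)"
  "Cmp (single_orbit_nominal_cat D G) X Y Z g f = compose (gcarrier X) g f"
  by (simp_all add: single_orbit_nominal_cat_def)

lemma is_category_single_orbit_nominal_cat:
  fixes G :: "('d \<Rightarrow> 'd, 'm) monoid_scheme"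
  shows "is_category (single_orbit_nominal_cat D G :: (('x, 'd \<Rightarrow> 'd) gset, 'x \<Rightarrow> 'x) category)"
  unfolding is_category_def
proof (intro conjI ballI)
  fix X :: "('x, 'd \<Rightarrow> 'd) gset"
  assume "X \<in> Obj (single_orbit_nominal_cat D G)"
  then show "Ide (single_orbit_nominal_cat D G) X \<in> Arr (single_orbit_nominal_cat D G) X X"
    by (auto simp: equivariant_maps_def nominal_def gact_closed)
next
  fix X Y :: "('x, 'd \<Rightarrow> 'd) gset" and f
  let ?C = "single_orbit_nominal_cat D G"
  assume "f \<in> Arr ?C X Y"
  then show "Cmp ?C X X Y f (Ide ?C X) = f" "Cmp ?C X Y Y (Ide ?C Y) f = f"
    by (auto simp: equivariant_maps_def PiE_def intro!: compose_Id Id_compose)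
next
  fix X Y Z :: "('x, 'd \<Rightarrow> 'd) gset" and f g
  let ?C = "single_orbit_nominal_cat D G"
  assume "X \<in> Obj ?C" "f \<in> Arr ?C X Y" "g \<in> Arr ?C Y Z"
  then show "Cmp ?C X Y Z g f \<in> Arr ?C X Z"
    by (auto simp: nominal_def gact_closed equivariant_maps_apply equivariant_maps_gact compose_eq
        equivariant_maps_def[of G X Z] compose_def)
next
  fix W X Y Z :: "('x, 'd \<Rightarrow> 'd) gset" and f g h
  let ?C = "single_orbit_nominal_cat D G"
  assume "f \<in> Arr ?C W X"
  then have "f \<in> gcarrier W \<rightarrow> gcarrier X"
    by (auto simp: equivariant_maps_def)
  then show "Cmp ?C W X Z (Cmp ?C X Y Z h g) f = Cmp ?C W Y Z h (Cmp ?C W X Y g f)"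
    by (simp add: compose_assoc)
qed

text \<open>The inverse of a bijective equivariant map is automatically equivariant, so essential
  surjectivity only has to produce a bijection.\<close>

lemma is_iso_single_orbit_nominal_cat:
  assumes X: "is_gset G X" and f: "f \<in> equivariant_maps G X Y"
    and bij: "bij_betw f (gcarrier X) (gcarrier Y)"
  shows "is_iso (single_orbit_nominal_cat D G) X Y f"
proof -
  define g where "g = (\<lambda>y \<in> gcarrier Y. inv_into (gcarrier X) f y)"
  have gf: "g (f x) = x" if "x \<in> gcarrier X" for x
    using bij that equivariant_maps_apply[OF f that] by (simp add: g_def bij_betw_def)
  have fg: "f (g y) = y" "g y \<in> gcarrier X" if "y \<in> gcarrier Y" for y
    using bij that by (auto simp: g_def bij_betw_def f_inv_into_f inv_into_into)
  have "g (gact Y y \<pi>) = gact X (g y) \<pi>" if "y \<in> gcarrier Y" "\<pi> \<in> carrier G" for y \<pi>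
    using fg[OF that(1)] equivariant_maps_gact[OF f _ that(2), of "g y"]
      gf[OF gact_closed[OF X _ that(2), of "g y"]] by simp
  then have "g \<in> equivariant_maps G Y X"
    using fg by (auto simp: equivariant_maps_def g_def)
  moreover have "compose (gcarrier X) g f = (\<lambda>x \<in> gcarrier X. x)"
    using gf by (auto simp: compose_def)
  moreover have "compose (gcarrier Y) f g = (\<lambda>x \<in> gcarrier Y. x)"
    using fg by (auto simp: compose_def)
  ultimately show ?thesis
    using f by (auto simp: is_iso_def)
qed

text \<open>Conjugation: if \<open>\<rho>\<close> fixes the image of \<open>C\<close> under
  \<open>\<pi>\<close> pointwise, then performing \<open>\<pi>\<close>, \<open>\<rho>\<close> and
  the inverse of \<open>\<pi>\<close> in this order fixes \<open>C\<close> pointwise, hence fixes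
  \<open>x\<close>. Acting with \<open>\<pi>\<close> once more shows that \<open>\<rho>\<close>
  fixes \<open>x \<cdot> \<pi>\<close>.\<close>

lemma finite_support_image:
  assumes X: "is_gset (aut_group \<Sigma> U) X" and x: "x \<in> gcarrier X" and \<pi>: "\<pi> \<in> isomorphisms \<Sigma> U U"
    and C: "finite_support (univ U) (aut_group \<Sigma> U) X C x"
  shows "finite_support (univ U) (aut_group \<Sigma> U) X (\<pi> ` C) (gact X x \<pi>)"
proof -
  let ?G = "aut_group \<Sigma> U"
  obtain \<pi>' where \<pi>': "\<pi>' \<in> isomorphisms \<Sigma> U U" "compose (univ U) \<pi> \<pi>' = (\<lambda>x \<in> univ U. x)"
    "compose (univ U) \<pi>' \<pi> = (\<lambda>x \<in> univ U. x)"
    using isomorphisms_inverse[OF \<pi>] .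
  have CU: "C \<subseteq> univ U"
    using C by (simp add: finite_support_def)
  have "gact X (gact X x \<pi>) \<rho> = gact X x \<pi>"
    if \<rho>: "\<rho> \<in> isomorphisms \<Sigma> U U" "\<forall>c \<in> \<pi> ` C. \<rho> c = c" for \<rho>
  proof -
    have \<pi>\<rho>: "\<pi> \<otimes>\<^bsub>?G\<^esub> \<rho> \<in> carrier ?G"
      using isomorphisms_compose[OF \<pi> \<rho>(1)] by simp
    have "(\<pi> \<otimes>\<^bsub>?G\<^esub> \<rho> \<otimes>\<^bsub>?G\<^esub> \<pi>') c = c" if "c \<in> C" for c
      using that \<rho>(2) CU fun_cong[OF \<pi>'(3), of c] by (auto simp: compose_eq)
    moreover have "\<pi> \<otimes>\<^bsub>?G\<^esub> \<rho> \<otimes>\<^bsub>?G\<^esub> \<pi>' \<in> carrier ?G"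
      using isomorphisms_compose[OF isomorphisms_compose[OF \<pi> \<rho>(1)] \<pi>'(1)] by simp
    ultimately have "gact X x (\<pi> \<otimes>\<^bsub>?G\<^esub> \<rho> \<otimes>\<^bsub>?G\<^esub> \<pi>') = x"
      using C unfolding finite_support_def supports_def by blast
    then have "gact X (gact X x (\<pi> \<otimes>\<^bsub>?G\<^esub> \<rho> \<otimes>\<^bsub>?G\<^esub> \<pi>')) \<pi> = gact X x \<pi>"
      by simp
    \<comment> \<open>The simplification rule for products is switched off, here and in similar
      steps, because unfolding a product into \<open>compose\<close> would hide it from the action
      and group laws.\<close>
    moreover have "gact X (gact X x (\<pi> \<otimes>\<^bsub>?G\<^esub> \<rho> \<otimes>\<^bsub>?G\<^esub> \<pi>')) \<pi> = gact X (gact X x (\<pi> \<otimes>\<^bsub>?G\<^esub> \<rho>)) (\<pi>' \<otimes>\<^bsub>?G\<^esub> \<pi>)"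
      using X x \<pi> \<pi>'(1) \<pi>\<rho> by (simp add: gact_mult gact_closed del: aut_group_simps(2))
    moreover have "\<pi>' \<otimes>\<^bsub>?G\<^esub> \<pi> = \<one>\<^bsub>?G\<^esub>"
      using \<pi>' by simp
    ultimately show ?thesis
      using X x \<pi> \<rho>(1) \<pi>\<rho> by (simp add: gact_mult gact_closed gact_one del: aut_group_simps(2,3))
  qed
  moreover have "\<pi> ` C \<subseteq> univ U"
    using CU embeddings_apply[OF isomorphisms_embeddings[OF \<pi>]] by auto
  ultimately show ?thesis
    using C by (simp add: finite_support_def supports_def)
qed

section \<open>The orbit attached to a structure with a subgroup\<close>

locale well_behaved_fraisse_symmetry =
  fixes \<Sigma> :: "'r signature" and K :: "('a, 'r) relstruct set" and U :: "('d, 'r) relstruct"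
    and ty :: "'x itself"
  assumes fraisse: "fraisse_class \<Sigma> K"
    and limit: "fraisse_limit \<Sigma> K U"
    and infinite: "infinite (UNIV :: 'x set)"
    and well_behaved: "well_behaved ty (univ U) (aut_group \<Sigma> U)"
begin

abbreviation G :: "('d \<Rightarrow> 'd) monoid" where
  "G \<equiv> aut_group \<Sigma> U"

lemma finite_univ: "A \<in> K \<Longrightarrow> finite (univ A)"
  using fraisse by (simp add: fraisse_class_def)

lemma ex_embedding:
  assumes "A \<in> K"
  obtains e where "e \<in> embeddings \<Sigma> A U"
proof -
  obtain X f where "X \<subseteq> univ U" "f \<in> isomorphisms \<Sigma> A (induced U X)"
    using limit assms unfolding fraisse_limit_def isomorphic_def by blast
  then show thesis
    using that isomorphisms_embeddings embeddings_induced_iff by metis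
qed

lemma ex_embedding_onto:
  assumes "finite X" "X \<subseteq> univ U"
  obtains A e where "A \<in> K" "e \<in> embeddings \<Sigma> A U" "e ` univ A = X"
proof -
  obtain A f where f: "A \<in> K" "f \<in> isomorphisms \<Sigma> A (induced U X)"
    using limit assms unfolding fraisse_limit_def isomorphic_def by blast
  then have "f ` univ A = X"
    using isomorphisms_image[OF f(2)] by (simp add: induced_def)
  then show thesis
    using that f assms isomorphisms_embeddings embeddings_induced_iff by metis
qed

text \<open>The inverse of \<open>e\<close> followed by \<open>e'\<close> is an isomorphism between
  two finite substructures of \<open>U\<close>, so it extends to an automorphism. All later uses of
  homogeneity take this form.\<close>

lemma homogeneous_embeddings:
  assumes A: "A \<in> K" and e: "e \<in> embeddings \<Sigma> A U" and e': "e' \<in> embeddings \<Sigma> A U"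
  obtains \<pi> where "\<pi> \<in> isomorphisms \<Sigma> U U" "compose (univ A) \<pi> e = e'"
proof -
  let ?X = "e ` univ A" and ?Y = "e' ` univ A"
  have XY: "finite ?X" "finite ?Y" "?X \<subseteq> univ U" "?Y \<subseteq> univ U"
    using finite_univ[OF A] embeddings_apply[OF e] embeddings_apply[OF e'] by auto
  have eX: "e \<in> isomorphisms \<Sigma> A (induced U ?X)"
    using e XY by (simp add: isomorphisms_def embeddings_induced_iff) (simp add: induced_def)
  have eY: "e' \<in> isomorphisms \<Sigma> A (induced U ?Y)"
    using e' XY by (simp add: isomorphisms_def embeddings_induced_iff) (simp add: induced_def)
  obtain g where g: "g \<in> isomorphisms \<Sigma> (induced U ?X) A" "compose (univ A) g e = (\<lambda>x \<in> univ A. x)"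
    using isomorphisms_inverse[OF eX] .
  have "compose (univ (induced U ?X)) e' g \<in> isomorphisms \<Sigma> (induced U ?X) (induced U ?Y)"
    using isomorphisms_compose[OF g(1) eY] .
  then obtain \<pi> where \<pi>: "\<pi> \<in> isomorphisms \<Sigma> U U" "\<And>x. x \<in> ?X \<Longrightarrow> \<pi> x = compose (univ (induced U ?X)) e' g x"
    using limit XY unfolding fraisse_limit_def homogeneous_def by (metis aut_group_simps(1))
  have "compose (univ A) \<pi> e a = e' a" if "a \<in> univ A" for a
    using that \<pi>(2)[of "e a"] fun_cong[OF g(2), of a] by (simp add: compose_eq induced_def)
  then have "compose (univ A) \<pi> e = e'"
    using embeddings_eqI[OF embeddings_compose[OF e isomorphisms_embeddings[OF \<pi>(1)]] e'] by blast
  then show thesis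
    using that \<pi> by blast
qed

text \<open>The classes form a countable set, which is encoded in the given infinite universe \<open>'x\<close>.\<close>

definition enc :: "('a, 'r) relstruct \<Rightarrow> ('a \<Rightarrow> 'a) set \<Rightarrow> ('a \<Rightarrow> 'd) set \<Rightarrow> 'x" where
  "enc A S = (SOME h. inj_on h (eclass A S ` embeddings \<Sigma> A U))"

text \<open>An embedding of the finite structure \<open>A\<close> is determined by its values along
  a list of the elements of \<open>A\<close>. Embeddings thus correspond to some of the lists over
  the countable limit, and their classes inject into \<open>nat\<close> and from there into
  \<open>'x\<close>.\<close>

lemma inj_on_enc:
  assumes "A \<in> K"
  shows "inj_on (enc A S) (eclass A S ` embeddings \<Sigma> A U)"
proof -
  obtain xs where xs: "set xs = univ A"
    using finite_list[OF finite_univ[OF assms]] by blast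
  have "inj_on (\<lambda>e. map e xs) (embeddings \<Sigma> A U)"
    using xs by (auto intro!: inj_onI embeddings_eqI)
  moreover have "(\<lambda>e. map e xs) ` embeddings \<Sigma> A U \<subseteq> lists (univ U)"
    using xs embeddings_apply by fastforce
  moreover have "countable (lists (univ U))"
    using limit by (simp add: fraisse_limit_def)
  ultimately have "countable (embeddings \<Sigma> A U)"
    by (meson countable_image_inj_on countable_subset)
  then have "countable (eclass A S ` embeddings \<Sigma> A U)"
    by (rule countable_image)
  then obtain f :: "('a \<Rightarrow> 'd) set \<Rightarrow> nat" where f: "inj_on f (eclass A S ` embeddings \<Sigma> A U)"
    unfolding countable_def by blast
  obtain g :: "nat \<Rightarrow> 'x" where g: "inj g"
    using infinite_countable_subset[OF infinite] by blast
  have "inj_on (g \<circ> f) (eclass A S ` embeddings \<Sigma> A U)"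
    using f g by (metis comp_inj_on inj_on_subset subset_UNIV)
  then show ?thesis
    unfolding enc_def by (rule someI[of "\<lambda>h. inj_on h (eclass A S ` embeddings \<Sigma> A U)"])
qed

definition pt :: "('a, 'r) relstruct \<Rightarrow> ('a \<Rightarrow> 'a) set \<Rightarrow> ('a \<Rightarrow> 'd) \<Rightarrow> 'x" where
  "pt A S e = enc A S (eclass A S e)"

text \<open>A coded point no longer carries an embedding, so one has to be chosen before an
  automorphism or a morphism can be applied to it.\<close>

definition rep :: "('a, 'r) relstruct \<Rightarrow> ('a \<Rightarrow> 'a) set \<Rightarrow> 'x \<Rightarrow> ('a \<Rightarrow> 'd)" where
  "rep A S x = (SOME e. e \<in> embeddings \<Sigma> A U \<and> pt A S e = x)"

definition orb :: "('a, 'r) relstruct \<Rightarrow> ('a \<Rightarrow> 'a) set \<Rightarrow> ('x, 'd \<Rightarrow> 'd) gset" where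
  "orb A S = \<lparr>gcarrier = pt A S ` embeddings \<Sigma> A U,
     gact = (\<lambda>x \<in> pt A S ` embeddings \<Sigma> A U. \<lambda>\<pi> \<in> carrier G. pt A S (compose (univ A) \<pi> (rep A S x)))\<rparr>"

text \<open>Two choices enter: an embedding for the point and a member of the morphism class.
  \<open>orb_map_pt\<close> shows that neither affects the value.\<close>

definition orb_map ::
    "('a, 'r) relstruct \<Rightarrow> ('a \<Rightarrow> 'a) set \<Rightarrow> ('a, 'r) relstruct \<Rightarrow> ('a \<Rightarrow> 'a) set \<Rightarrow>
     ('a \<Rightarrow> 'a) set \<Rightarrow> 'x \<Rightarrow> 'x" where
  "orb_map A S B T m =
     (\<lambda>x \<in> gcarrier (orb A S). pt B T (compose (univ B) (rep A S x) (SOME u. u \<in> m)))"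

lemma gcarrier_orb: "gcarrier (orb A S) = pt A S ` embeddings \<Sigma> A U"
  by (simp add: orb_def)

lemma pt_in_orb: "e \<in> embeddings \<Sigma> A U \<Longrightarrow> pt A S e \<in> gcarrier (orb A S)"
  by (simp add: gcarrier_orb)

lemma pt_eq_iff:
  "\<lbrakk>A \<in> K; e \<in> embeddings \<Sigma> A U; e' \<in> embeddings \<Sigma> A U\<rbrakk>
    \<Longrightarrow> pt A S e = pt A S e' \<longleftrightarrow> eclass A S e = eclass A S e'"
  using inj_on_enc[of A S] by (auto simp: pt_def dest: inj_onD)

lemma rep:
  assumes "e \<in> embeddings \<Sigma> A U"
  shows "rep A S (pt A S e) \<in> embeddings \<Sigma> A U" "pt A S (rep A S (pt A S e)) = pt A S e"
proof -
  have "\<exists>e'. e' \<in> embeddings \<Sigma> A U \<and> pt A S e' = pt A S e"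
    using assms by blast
  from someI_ex[OF this] show "rep A S (pt A S e) \<in> embeddings \<Sigma> A U" "pt A S (rep A S (pt A S e)) = pt A S e"
    unfolding rep_def by blast+
qed

lemma embeddings_automorphism:
  "\<lbrakk>\<pi> \<in> isomorphisms \<Sigma> U U; e \<in> embeddings \<Sigma> A U\<rbrakk> \<Longrightarrow> compose (univ A) \<pi> e \<in> embeddings \<Sigma> A U"
  by (rule embeddings_compose[OF _ isomorphisms_embeddings])

text \<open>The chosen representative of \<open>[e]\<close> differs from \<open>e\<close> by an
  element of \<open>S\<close> on the right, and postcomposition with \<open>\<pi>\<close> preserves
  that relation.\<close>

lemma gact_orb:
  assumes "A \<in> K" "subgroup S (aut_group \<Sigma> A)" "e \<in> embeddings \<Sigma> A U" "\<pi> \<in> isomorphisms \<Sigma> U U"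
  shows "gact (orb A S) (pt A S e) \<pi> = pt A S (compose (univ A) \<pi> e)"
proof -
  note rep = rep[OF assms(3), of S]
  have "eclass A S (rep A S (pt A S e)) = eclass A S e"
    using rep pt_eq_iff[OF assms(1) rep(1) assms(3)] by simp
  then have "pt A S (compose (univ A) \<pi> (rep A S (pt A S e))) = pt A S (compose (univ A) \<pi> e)"
    using eclass_compose_left[OF assms(2) rep(1) assms(3) isomorphisms_embeddings[OF assms(4)]]
    unfolding pt_def[of A S "compose (univ A) \<pi> _"] by simp
  then show ?thesis
    using assms by (simp add: orb_def)
qed

lemma is_gset_orb:
  assumes "A \<in> K" "subgroup S (aut_group \<Sigma> A)"
  shows "is_gset G (orb A S)"
  unfolding is_gset_def
proof (intro conjI ballI)
  have "gact (orb A S) x \<pi> \<in> gcarrier (orb A S)"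
    if "x \<in> gcarrier (orb A S)" "\<pi> \<in> isomorphisms \<Sigma> U U" for x \<pi>
    using that by (auto simp: gcarrier_orb gact_orb[OF assms] intro!: imageI embeddings_automorphism)
  moreover have "gact (orb A S) x \<in> extensional (isomorphisms \<Sigma> U U)" if "x \<in> gcarrier (orb A S)" for x
    using that by (auto simp: orb_def)
  moreover have "gact (orb A S) \<in> extensional (gcarrier (orb A S))"
    by (simp add: orb_def)
  ultimately show "gact (orb A S) \<in> gcarrier (orb A S) \<rightarrow>\<^sub>E carrier G \<rightarrow>\<^sub>E gcarrier (orb A S)"
    by (simp add: PiE_iff)
next
  fix x \<pi> \<sigma> assume "x \<in> gcarrier (orb A S)" "\<pi> \<in> carrier G" "\<sigma> \<in> carrier G"
  then show "gact (orb A S) x (\<pi> \<otimes>\<^bsub>G\<^esub> \<sigma>) = gact (orb A S) (gact (orb A S) x \<pi>) \<sigma>"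
    by (auto simp: gcarrier_orb gact_orb[OF assms] embeddings_automorphism embeddings_compose_assoc
        isomorphisms_compose[where A = U and B = U])
next
  fix x assume "x \<in> gcarrier (orb A S)"
  then show "gact (orb A S) x \<one>\<^bsub>G\<^esub> = x"
    by (auto simp: gcarrier_orb gact_orb[OF assms] isomorphisms_id embeddings_compose_id)
qed

lemma finite_support_orb:
  assumes "A \<in> K" "subgroup S (aut_group \<Sigma> A)" "e \<in> embeddings \<Sigma> A U"
  shows "finite_support (univ U) G (orb A S) (e ` univ A) (pt A S e)"
proof -
  have "compose (univ A) \<pi> e = e" if "\<pi> \<in> isomorphisms \<Sigma> U U" "\<forall>c \<in> e ` univ A. \<pi> c = c" for \<pi>
    using that by (intro embeddings_eqI[OF embeddings_automorphism assms(3)] assms) (auto simp: compose_eq)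
  then show ?thesis
    using finite_univ[OF assms(1)] embeddings_apply[OF assms(3)]
    by (auto simp: finite_support_def supports_def gact_orb[OF assms])
qed

lemma nominal_orb:
  "\<lbrakk>A \<in> K; subgroup S (aut_group \<Sigma> A)\<rbrakk> \<Longrightarrow> nominal (univ U) G (orb A S)"
  using is_gset_orb finite_support_orb unfolding nominal_def gcarrier_orb by blast

lemma single_orbit_orb:
  assumes "A \<in> K" "subgroup S (aut_group \<Sigma> A)"
  shows "single_orbit G (orb A S)"
proof -
  obtain e where e: "e \<in> embeddings \<Sigma> A U"
    using ex_embedding[OF assms(1)] .
  have "y \<in> gact (orb A S) (pt A S e) ` carrier G" if y: "y \<in> gcarrier (orb A S)" for y
  proof -
    obtain e' where e': "e' \<in> embeddings \<Sigma> A U" "y = pt A S e'"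
      using y by (auto simp: gcarrier_orb)
    obtain \<pi> where "\<pi> \<in> isomorphisms \<Sigma> U U" "compose (univ A) \<pi> e = e'"
      using homogeneous_embeddings[OF assms(1) e e'(1)] .
    then show ?thesis
      using e' gact_orb[OF assms e] by auto
  qed
  then show ?thesis
    using pt_in_orb[OF e] gact_closed[OF is_gset_orb[OF assms]] unfolding single_orbit_def by blast
qed

section \<open>Supports in the orbits of embeddings\<close>

lemma ex_least_support:
  fixes X :: "('x, 'd \<Rightarrow> 'd) gset"
  assumes "nominal (univ U) G X" "x \<in> gcarrier X"
  obtains C where "finite_support (univ U) G X C x"
    "\<forall>C'. finite_support (univ U) G X C' x \<longrightarrow> C \<subseteq> C'"
  using well_behaved assms unfolding well_behaved_def by blast

text \<open>Suppose that a point \<open>c\<close> of the image were missing from the least support.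
  Fungibility gives \<open>\<pi>\<close> moving \<open>c\<close> and fixing the rest of the image.
  It fixes \<open>[e]\<close>, so it maps the image into itself, and \<open>\<pi> c\<close> is one
  of the other points. But those are fixed, which contradicts injectivity.\<close>

lemma finite_support_orb_superset:
  assumes A: "A \<in> K" "subgroup S (aut_group \<Sigma> A)" and e: "e \<in> embeddings \<Sigma> A U"
    and C': "finite_support (univ U) G (orb A S) C' (pt A S e)"
  shows "e ` univ A \<subseteq> C'"
proof -
  obtain C where C: "finite_support (univ U) G (orb A S) C (pt A S e)"
    and least: "\<forall>C'. finite_support (univ U) G (orb A S) C' (pt A S e) \<longrightarrow> C \<subseteq> C'"
    using ex_least_support[OF nominal_orb[OF A] pt_in_orb[OF e]] .
  have "c \<in> C" if c: "c \<in> e ` univ A" for c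
  proof (rule ccontr)
    assume "c \<notin> C"
    \<comment> \<open>Leastness is essential here: it places \<open>C\<close> inside the image, so
      that \<open>\<pi>\<close> fixes all of \<open>C\<close>. Fungibility says nothing about points
      of an arbitrary support outside the image.\<close>
    have sub: "C \<subseteq> e ` univ A"
      using least finite_support_orb[OF A e] by blast
    have "finite (e ` univ A)" "e ` univ A \<subseteq> univ U"
      using finite_univ[OF A(1)] embeddings_apply[OF e] by auto
    then have "fungible G (e ` univ A)"
      using well_behaved by (simp add: well_behaved_def)
    then obtain \<pi> where \<pi>: "\<pi> \<in> isomorphisms \<Sigma> U U" "\<pi> c \<noteq> c" "\<forall>c' \<in> e ` univ A - {c}. \<pi> c' = c'"
      using c by (auto simp: fungible_def)
    have "\<forall>c \<in> C. \<pi> c = c"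
      using \<pi>(3) sub \<open>c \<notin> C\<close> by blast
    then have "gact (orb A S) (pt A S e) \<pi> = pt A S e"
      using C \<pi>(1) by (simp add: finite_support_def supports_def)
    then have "eclass A S e = eclass A S (compose (univ A) \<pi> e)"
      using gact_orb[OF A e \<pi>(1)] pt_eq_iff[OF A(1) e embeddings_automorphism[OF \<pi>(1) e]] by metis
    then obtain \<sigma> where \<sigma>: "\<sigma> \<in> S" "compose (univ A) \<pi> e = compose (univ A) e \<sigma>"
      using eclass_eq_iff[OF A(2) e embeddings_automorphism[OF \<pi>(1) e]] by blast
    obtain a where a: "a \<in> univ A" "c = e a"
      using c by blast
    have "\<pi> c = e (\<sigma> a)" and \<sigma>a: "\<sigma> a \<in> univ A"
      using fun_cong[OF \<sigma>(2), of a] a embeddings_apply[OF aut_subgroup_embeddings[OF A(2) \<sigma>(1)]]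
      by (auto simp: compose_eq)
    \<comment> \<open>Since \<open>\<pi> c\<close> lies in the image and differs from
      \<open>c\<close>, it is itself fixed by \<open>\<pi>\<close>; so \<open>\<pi>\<close> takes
      the same value at \<open>c\<close> and at \<open>\<pi> c\<close>.\<close>
    then have "\<pi> c \<in> e ` univ A - {c}"
      using \<pi>(2) by simp
    then have "\<pi> (\<pi> c) = \<pi> c"
      using \<pi>(3) by blast
    moreover have "inj_on \<pi> (univ U)" "c \<in> univ U" "\<pi> c \<in> univ U"
      using embeddings_inj_on[OF isomorphisms_embeddings[OF \<pi>(1)]] embeddings_apply[OF e] a \<sigma>a \<open>\<pi> c = e (\<sigma> a)\<close>
      by auto
    ultimately show False
      using \<pi>(2) by (auto dest: inj_onD)
  qed
  then show ?thesis
    using least C' by blast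
qed

section \<open>The functor on morphisms: well-definedness, faithfulness, fullness\<close>

text \<open>The representative of the morphism is exchanged by \<open>eclass_compose_left\<close>,
  that of the point by \<open>eclass_compose_right\<close>; only the second exchange uses
  admissibility.\<close>

lemma orb_map_pt:
  assumes A: "A \<in> K" "subgroup S (aut_group \<Sigma> A)" and B: "B \<in> K" "subgroup T (aut_group \<Sigma> B)"
    and u: "u \<in> admissible_embeddings \<Sigma> (A, S) (B, T)" and e: "e \<in> embeddings \<Sigma> A U"
  shows "orb_map A S B T (eclass B T u) (pt A S e) = pt B T (compose (univ B) e u)"
proof -
  note ue = admissible_embeddings_embeddings[OF u]
  note rep = rep[OF e, of S]
  define v where "v = (SOME v. v \<in> eclass B T u)"
  have v: "v \<in> eclass B T u"
    unfolding v_def using eclass_self[OF B(2) ue] by (rule someI[of "\<lambda>v. v \<in> eclass B T u"])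
  then obtain \<tau> where "\<tau> \<in> T" "v = compose (univ B) u \<tau>"
    by (auto simp: eclass_def)
  then have vu: "eclass B T v = eclass B T u"
    using eclass_compose[OF B(2) ue] by simp
  have "eclass A S (rep A S (pt A S e)) = eclass A S e"
    using rep pt_eq_iff[OF A(1) rep(1) e] by simp
  then have "pt B T (compose (univ B) (rep A S (pt A S e)) v) = pt B T (compose (univ B) e u)"
    unfolding pt_def using eclass_compose_left[OF B(2) eclass_embeddings[OF B(2) ue v] ue rep(1) vu]
      eclass_compose_right[OF A(2) B(2) u rep(1) e] pt_def by simp
  then show ?thesis
    using pt_in_orb[OF e] by (simp add: orb_map_def v_def)
qed

lemma orb_map_equivariant:
  assumes A: "A \<in> K" "subgroup S (aut_group \<Sigma> A)" and B: "B \<in> K" "subgroup T (aut_group \<Sigma> B)"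
    and u: "u \<in> admissible_embeddings \<Sigma> (A, S) (B, T)"
  shows "orb_map A S B T (eclass B T u) \<in> equivariant_maps G (orb A S) (orb B T)"
proof -
  note ue = admissible_embeddings_embeddings[OF u]
  have "orb_map A S B T (eclass B T u) (pt A S e) \<in> gcarrier (orb B T)" if "e \<in> embeddings \<Sigma> A U" for e
    using that by (simp add: orb_map_pt[OF A B u] pt_in_orb embeddings_compose[OF ue])
  moreover have "orb_map A S B T (eclass B T u) (gact (orb A S) (pt A S e) \<pi>) =
      gact (orb B T) (orb_map A S B T (eclass B T u) (pt A S e)) \<pi>"
    if "e \<in> embeddings \<Sigma> A U" "\<pi> \<in> isomorphisms \<Sigma> U U" for e \<pi>
    using that
    by (simp add: orb_map_pt[OF A B u] gact_orb[OF A] gact_orb[OF B] embeddings_compose[OF ue]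
        embeddings_automorphism embeddings_compose_assoc[OF ue])
  moreover have "orb_map A S B T (eclass B T u) \<in> extensional (gcarrier (orb A S))"
    by (simp add: orb_map_def)
  ultimately show ?thesis
    unfolding equivariant_maps_def by (auto simp: PiE_iff gcarrier_orb)
qed

text \<open>One point is enough: equal values at \<open>[e]\<close> give
  \<open>e \<circ> v = e \<circ> u \<circ> \<tau>\<close>, and \<open>e\<close> can be
  cancelled.\<close>

lemma orb_map_faithful:
  assumes A: "A \<in> K" "subgroup S (aut_group \<Sigma> A)" and B: "B \<in> K" "subgroup T (aut_group \<Sigma> B)"
    and u: "u \<in> admissible_embeddings \<Sigma> (A, S) (B, T)" and v: "v \<in> admissible_embeddings \<Sigma> (A, S) (B, T)"
    and eq: "orb_map A S B T (eclass B T u) = orb_map A S B T (eclass B T v)"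
  shows "eclass B T u = eclass B T v"
proof -
  note ue = admissible_embeddings_embeddings[OF u] and ve = admissible_embeddings_embeddings[OF v]
  obtain e where e: "e \<in> embeddings \<Sigma> A U"
    using ex_embedding[OF A(1)] .
  have "pt B T (compose (univ B) e u) = pt B T (compose (univ B) e v)"
    using fun_cong[OF eq, of "pt A S e"] by (simp add: orb_map_pt[OF A B u e] orb_map_pt[OF A B v e])
  then obtain \<tau> where \<tau>: "\<tau> \<in> T" "compose (univ B) e v = compose (univ B) (compose (univ B) e u) \<tau>"
    using pt_eq_iff[OF B(1)] eclass_eq_iff[OF B(2)] embeddings_compose[OF ue e] embeddings_compose[OF ve e]
    by metis
  note \<tau>e = aut_subgroup_embeddings[OF B(2) \<tau>(1)]
  have "compose (univ B) e v = compose (univ B) e (compose (univ B) u \<tau>)"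
    using \<tau>(2) embeddings_compose_assoc[OF \<tau>e] by simp
  then have "v = compose (univ B) u \<tau>"
    by (rule embeddings_cancel[OF e ve embeddings_compose[OF \<tau>e ue]])
  then show ?thesis
    using eclass_eq_iff[OF B(2) ue ve] \<tau>(1) by blast
qed

lemma orb_map_full:
  assumes A: "A \<in> K" "subgroup S (aut_group \<Sigma> A)" and B: "B \<in> K" "subgroup T (aut_group \<Sigma> B)"
    and f: "f \<in> equivariant_maps G (orb A S) (orb B T)"
  obtains u where "u \<in> admissible_embeddings \<Sigma> (A, S) (B, T)" "orb_map A S B T (eclass B T u) = f"
proof -
  obtain e where e: "e \<in> embeddings \<Sigma> A U"
    using ex_embedding[OF A(1)] .
  obtain e' where e': "e' \<in> embeddings \<Sigma> B U" "f (pt A S e) = pt B T e'"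
    using equivariant_maps_apply[OF f pt_in_orb[OF e]] by (auto simp: gcarrier_orb)
  have f_act: "f (pt A S (compose (univ A) \<pi> e)) = pt B T (compose (univ B) \<pi> e')"
    if "\<pi> \<in> isomorphisms \<Sigma> U U" for \<pi>
    using equivariant_maps_gact[OF f pt_in_orb[OF e], of \<pi>] that
    by (simp add: gact_orb[OF A e] gact_orb[OF B e'(1)] e'(2))
  \<comment> \<open>Equivariant maps do not enlarge supports: whatever fixes \<open>[e]\<close> also
    fixes its value under \<open>f\<close>.\<close>
  have "finite_support (univ U) G (orb B T) (e ` univ A) (f (pt A S e))"
    using finite_support_orb[OF A e] equivariant_maps_gact[OF f pt_in_orb[OF e]]
    by (simp add: finite_support_def supports_def) metis
  then have "e' ` univ B \<subseteq> e ` univ A"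
    using finite_support_orb_superset[OF B e'(1)] e'(2) by simp
  then obtain u where u: "u \<in> embeddings \<Sigma> B A" "compose (univ B) e u = e'"
    using embeddings_factor[OF e e'(1)] by blast
  \<comment> \<open>The formula holds at \<open>e\<close> by the choice of \<open>u\<close>; since
    the orbit is single, equivariance carries it to every other embedding.\<close>
  have f_pt: "f (pt A S d) = pt B T (compose (univ B) d u)" if d: "d \<in> embeddings \<Sigma> A U" for d
  proof -
    obtain \<pi> where "\<pi> \<in> isomorphisms \<Sigma> U U" "compose (univ A) \<pi> e = d"
      using homogeneous_embeddings[OF A(1) e d] .
    then show ?thesis
      using f_act embeddings_compose_assoc[OF u(1), of \<pi> e] u(2) by metis
  qed
  \<comment> \<open>Admissibility comes from \<open>f\<close> being a function on classes:
    \<open>e \<circ> \<sigma>\<close> and \<open>e\<close> name the same point, so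
    \<open>e \<circ> \<sigma> \<circ> u\<close> and \<open>e \<circ> u\<close> are equivalent modulo
    \<open>T\<close>, and \<open>e\<close> cancels.\<close>
  have "\<exists>\<tau> \<in> T. compose (univ B) \<sigma> u = compose (univ B) u \<tau>" if \<sigma>: "\<sigma> \<in> S" for \<sigma>
  proof -
    note \<sigma>e = aut_subgroup_embeddings[OF A(2) \<sigma>]
    note e\<sigma> = embeddings_compose[OF \<sigma>e e]
    have "pt A S (compose (univ A) e \<sigma>) = pt A S e"
      using eclass_compose[OF A(2) e \<sigma>] by (simp add: pt_def)
    then have "pt B T (compose (univ B) (compose (univ A) e \<sigma>) u) = pt B T e'"
      using f_pt[OF e\<sigma>] e'(2) by simp
    then obtain \<tau> where \<tau>: "\<tau> \<in> T" "compose (univ B) (compose (univ A) e \<sigma>) u = compose (univ B) e' \<tau>"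
      using pt_eq_iff[OF B(1)] eclass_eq_iff[OF B(2)] embeddings_compose[OF u(1) e\<sigma>] e'(1) by metis
    note \<tau>e = aut_subgroup_embeddings[OF B(2) \<tau>(1)]
    have "compose (univ B) e (compose (univ B) \<sigma> u) = compose (univ B) e (compose (univ B) u \<tau>)"
      using \<tau>(2) embeddings_compose_assoc[OF u(1), of e \<sigma>] embeddings_compose_assoc[OF \<tau>e, of e u] u(2)
      by simp
    then have "compose (univ B) \<sigma> u = compose (univ B) u \<tau>"
      by (rule embeddings_cancel[OF e embeddings_compose[OF u(1) \<sigma>e] embeddings_compose[OF \<tau>e u(1)]])
    then show ?thesis
      using \<tau>(1) by blast
  qed
  then have adm: "u \<in> admissible_embeddings \<Sigma> (A, S) (B, T)"
    using u(1) by (simp add: admissible_embeddings_def)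
  moreover have "orb_map A S B T (eclass B T u) = f"
    by (rule equivariant_maps_eqI[OF orb_map_equivariant[OF A B adm] f])
      (auto simp: gcarrier_orb orb_map_pt[OF A B adm] f_pt)
  ultimately show thesis
    using that by blast
qed

section \<open>Essential surjectivity\<close>

text \<open>The image of \<open>C\<close> again supports \<open>x \<cdot> \<pi> = x\<close>, so
  leastness puts \<open>C\<close> inside it; as \<open>C\<close> is finite, counting gives
  equality.\<close>

lemma least_support_invariant:
  fixes X :: "('x, 'd \<Rightarrow> 'd) gset"
  assumes X: "is_gset G X" and x: "x \<in> gcarrier X" and C: "finite_support (univ U) G X C x"
    and least: "\<forall>C'. finite_support (univ U) G X C' x \<longrightarrow> C \<subseteq> C'"
    and \<pi>: "\<pi> \<in> isomorphisms \<Sigma> U U" "gact X x \<pi> = x"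
  shows "\<pi> ` C = C"
proof -
  have "C \<subseteq> \<pi> ` C"
    using finite_support_image[OF X x \<pi>(1) C] \<pi>(2) least by simp
  moreover have "finite C"
    using C by (simp add: finite_support_def)
  ultimately show ?thesis
    by (metis card_image_le card_seteq finite_imageI)
qed

lemma orb_ess_surj:
  fixes X :: "('x, 'd \<Rightarrow> 'd) gset"
  assumes nom: "nominal (univ U) G X" and so: "single_orbit G X"
  obtains A S t where "A \<in> K" "subgroup S (aut_group \<Sigma> A)"
    "is_iso (single_orbit_nominal_cat (univ U) G) X (orb A S) t"
proof -
  interpret G: group G
    by (rule group_aut_group)
  have X: "is_gset G X"
    using nom by (simp add: nominal_def)
  obtain x where x: "x \<in> gcarrier X" and X_eq: "gcarrier X = gact X x ` carrier G"
    using so by (auto simp: single_orbit_def)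
  obtain C where C: "finite_support (univ U) G X C x"
    and least: "\<forall>C'. finite_support (univ U) G X C' x \<longrightarrow> C \<subseteq> C'"
    using ex_least_support[OF nom x] .
  obtain A e where A: "A \<in> K" and e: "e \<in> embeddings \<Sigma> A U" and e_im: "e ` univ A = C"
    using ex_embedding_onto[of C] C by (auto simp: finite_support_def)
  define S where "S = {\<sigma> \<in> isomorphisms \<Sigma> A A.
    \<exists>\<pi> \<in> isomorphisms \<Sigma> U U. compose (univ A) \<pi> e = compose (univ A) e \<sigma> \<and> gact X x \<pi> = x}"
  \<comment> \<open>Each stabilizing automorphism preserves the least support, which is the image of
    \<open>e\<close>, and therefore factors through \<open>e\<close> as an automorphism of
    \<open>A\<close>.\<close>
  have stab: "\<exists>\<sigma> \<in> S. compose (univ A) \<pi> e = compose (univ A) e \<sigma>"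
    if \<pi>: "\<pi> \<in> isomorphisms \<Sigma> U U" "gact X x \<pi> = x" for \<pi>
  proof -
    have "compose (univ A) \<pi> e ` univ A = \<pi> ` C"
      by (auto simp: e_im[symmetric] compose_eq)
    then have "compose (univ A) \<pi> e ` univ A = e ` univ A"
      using least_support_invariant[OF X x C least \<pi>] e_im by simp
    then obtain \<sigma> where "\<sigma> \<in> isomorphisms \<Sigma> A A" "compose (univ A) e \<sigma> = compose (univ A) \<pi> e"
      using isomorphisms_factor[OF e embeddings_automorphism[OF \<pi>(1) e]] by blast
    then show ?thesis
      using \<pi> unfolding S_def by (intro bexI[of _ \<sigma>]) auto
  qed
  \<comment> \<open>Comparing two points of the orbit is reduced to asking whether a single group
    element stabilizes \<open>x\<close>.\<close>
  have inv: "gact X x (\<pi> \<otimes>\<^bsub>G\<^esub> inv\<^bsub>G\<^esub> \<pi>') = x \<longleftrightarrow> gact X x \<pi> = gact X x \<pi>'"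
    if "\<pi> \<in> carrier G" "\<pi>' \<in> carrier G" for \<pi> \<pi>'
  proof
    assume "gact X x (\<pi> \<otimes>\<^bsub>G\<^esub> inv\<^bsub>G\<^esub> \<pi>') = x"
    then have "gact X x ((\<pi> \<otimes>\<^bsub>G\<^esub> inv\<^bsub>G\<^esub> \<pi>') \<otimes>\<^bsub>G\<^esub> \<pi>') = gact X x \<pi>'"
      using that gact_mult[OF X x] by (metis G.inv_closed G.m_closed)
    then show "gact X x \<pi> = gact X x \<pi>'"
      using that by (simp add: G.m_assoc del: aut_group_simps)
  next
    assume "gact X x \<pi> = gact X x \<pi>'"
    then have "gact X x (\<pi> \<otimes>\<^bsub>G\<^esub> inv\<^bsub>G\<^esub> \<pi>') = gact X x (\<pi>' \<otimes>\<^bsub>G\<^esub> inv\<^bsub>G\<^esub> \<pi>')"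
      using that gact_mult[OF X x] by (metis G.inv_closed)
    then show "gact X x (\<pi> \<otimes>\<^bsub>G\<^esub> inv\<^bsub>G\<^esub> \<pi>') = x"
      using that by (simp add: gact_one[OF X x] del: aut_group_simps)
  qed
  \<comment> \<open>Because \<open>C\<close> supports \<open>x\<close>, the point
    \<open>x \<cdot> \<pi>\<close> depends only on the restriction of \<open>\<pi>\<close> to
    \<open>C\<close>, that is, on \<open>\<pi> \<circ> e\<close>.\<close>
  have agree: "gact X x \<pi> = gact X x \<pi>'"
    if "\<pi> \<in> carrier G" "\<pi>' \<in> carrier G" "compose (univ A) \<pi> e = compose (univ A) \<pi>' e" for \<pi> \<pi>'
  proof -
    have "(\<pi> \<otimes>\<^bsub>G\<^esub> inv\<^bsub>G\<^esub> \<pi>') c = c" if c_in: "c \<in> C" for c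
    proof -
      obtain a where a: "a \<in> univ A" "c = e a"
        using c_in e_im by blast
      have c: "c \<in> univ U"
        using a embeddings_apply[OF e] by simp
      have "(\<pi> \<otimes>\<^bsub>G\<^esub> inv\<^bsub>G\<^esub> \<pi>') c = (\<pi>' \<otimes>\<^bsub>G\<^esub> inv\<^bsub>G\<^esub> \<pi>') c"
        using fun_cong[OF \<open>compose (univ A) \<pi> e = compose (univ A) \<pi>' e\<close>, of a] a c
        by (simp add: compose_eq)
      then show ?thesis
        using G.r_inv[OF \<open>\<pi>' \<in> carrier G\<close>] c by simp
    qed
    then have "gact X x (\<pi> \<otimes>\<^bsub>G\<^esub> inv\<^bsub>G\<^esub> \<pi>') = x"
      using C that G.m_closed G.inv_closed unfolding finite_support_def supports_def by blast
    then show ?thesis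
      using inv that by blast
  qed
  have mult_e: "compose (univ A) (\<pi> \<otimes>\<^bsub>G\<^esub> \<rho>) e = compose (univ A) \<rho> (compose (univ A) \<pi> e)" for \<pi> \<rho>
    by (simp add: embeddings_compose_assoc[OF e])
  \<comment> \<open>Read in its two directions, this makes the assignment of
    \<open>[\<pi> \<circ> e]\<close> to \<open>x \<cdot> \<pi>\<close> well defined and injective.
    It is also the source of inverses in the proof that \<open>S\<close> is a subgroup.\<close>
  have key: "gact X x \<pi> = gact X x \<pi>' \<longleftrightarrow>
      (\<exists>\<sigma> \<in> S. compose (univ A) \<pi> e = compose (univ A) (compose (univ A) \<pi>' e) \<sigma>)"
    if \<pi>: "\<pi> \<in> carrier G" "\<pi>' \<in> carrier G" for \<pi> \<pi>'
  proof
    assume "gact X x \<pi> = gact X x \<pi>'"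
    then have "gact X x (\<pi> \<otimes>\<^bsub>G\<^esub> inv\<^bsub>G\<^esub> \<pi>') = x"
      using inv \<pi> by blast
    then obtain \<sigma> where \<sigma>: "\<sigma> \<in> S" "compose (univ A) (\<pi> \<otimes>\<^bsub>G\<^esub> inv\<^bsub>G\<^esub> \<pi>') e = compose (univ A) e \<sigma>"
      using stab \<pi> G.m_closed G.inv_closed aut_group_simps(1) by metis
    have \<sigma>e: "\<sigma> \<in> embeddings \<Sigma> A A"
      using \<sigma>(1) isomorphisms_embeddings by (auto simp: S_def)
    have "\<pi> = (\<pi> \<otimes>\<^bsub>G\<^esub> inv\<^bsub>G\<^esub> \<pi>') \<otimes>\<^bsub>G\<^esub> \<pi>'"
      using \<pi> by (simp add: G.m_assoc del: aut_group_simps)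
    then have "compose (univ A) \<pi> e = compose (univ A) \<pi>' (compose (univ A) e \<sigma>)"
      using mult_e \<sigma>(2) by metis
    then show "\<exists>\<sigma> \<in> S. compose (univ A) \<pi> e = compose (univ A) (compose (univ A) \<pi>' e) \<sigma>"
      using \<sigma>(1) embeddings_compose_assoc[OF \<sigma>e] by metis
  next
    assume "\<exists>\<sigma> \<in> S. compose (univ A) \<pi> e = compose (univ A) (compose (univ A) \<pi>' e) \<sigma>"
    then obtain \<sigma> \<rho> where \<sigma>: "\<sigma> \<in> isomorphisms \<Sigma> A A"
      "compose (univ A) \<pi> e = compose (univ A) (compose (univ A) \<pi>' e) \<sigma>"
      and \<rho>: "\<rho> \<in> carrier G" "compose (univ A) \<rho> e = compose (univ A) e \<sigma>" "gact X x \<rho> = x"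
      by (auto simp: S_def)
    have "compose (univ A) \<pi> e = compose (univ A) (\<rho> \<otimes>\<^bsub>G\<^esub> \<pi>') e"
      using \<sigma>(2) \<rho>(2) mult_e[of \<rho> \<pi>'] embeddings_compose_assoc[OF isomorphisms_embeddings[OF \<sigma>(1)], of \<pi>' e]
      by simp
    then have "gact X x \<pi> = gact X x (\<rho> \<otimes>\<^bsub>G\<^esub> \<pi>')"
      using agree \<pi>(1) G.m_closed[OF \<rho>(1) \<pi>(2)] by blast
    then show "gact X x \<pi> = gact X x \<pi>'"
      using gact_mult[OF X x \<rho>(1) \<pi>(2)] \<rho>(3) by simp
  qed
  have S: "subgroup S (aut_group \<Sigma> A)"
  proof (rule group.subgroupI[OF group_aut_group])
    show "S \<subseteq> carrier (aut_group \<Sigma> A)"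
      by (auto simp: S_def)
    show "S \<noteq> {}"
      using stab[of "\<one>\<^bsub>G\<^esub>"] gact_one[OF X x] isomorphisms_id[of U \<Sigma>] by auto
  next
    fix \<sigma> \<tau> assume "\<sigma> \<in> S" "\<tau> \<in> S"
    then have \<sigma>: "\<sigma> \<in> isomorphisms \<Sigma> A A" "\<tau> \<in> isomorphisms \<Sigma> A A"
      by (simp_all add: S_def)
    obtain \<pi> where \<pi>: "\<pi> \<in> carrier G" "compose (univ A) \<pi> e = compose (univ A) e \<sigma>" "gact X x \<pi> = x"
      using \<open>\<sigma> \<in> S\<close> by (auto simp: S_def)
    obtain \<rho> where \<rho>: "\<rho> \<in> carrier G" "compose (univ A) \<rho> e = compose (univ A) e \<tau>" "gact X x \<rho> = x"
      using \<open>\<tau> \<in> S\<close> by (auto simp: S_def)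
    note \<sigma>e = isomorphisms_embeddings[OF \<sigma>(1)]
    have "compose (univ A) (\<pi> \<otimes>\<^bsub>G\<^esub> \<rho>) e = compose (univ A) e (compose (univ A) \<tau> \<sigma>)"
      unfolding mult_e \<pi>(2) using \<rho>(2) embeddings_compose_assoc[OF \<sigma>e, of \<rho> e]
        embeddings_compose_assoc[OF \<sigma>e, of e \<tau>] by simp
    moreover have "gact X x (\<pi> \<otimes>\<^bsub>G\<^esub> \<rho>) = x"
      using gact_mult[OF X x \<pi>(1) \<rho>(1)] \<pi>(3) \<rho>(3) by simp
    moreover have "\<pi> \<otimes>\<^bsub>G\<^esub> \<rho> \<in> isomorphisms \<Sigma> U U"
      using G.m_closed[OF \<pi>(1) \<rho>(1)] by (simp del: aut_group_simps(2))
    ultimately show "\<sigma> \<otimes>\<^bsub>aut_group \<Sigma> A\<^esub> \<tau> \<in> S"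
      unfolding S_def using isomorphisms_compose[OF \<sigma>] by (simp del: aut_group_simps(2)) auto
  next
    fix \<sigma> assume "\<sigma> \<in> S"
    then obtain \<pi> where \<sigma>: "\<sigma> \<in> isomorphisms \<Sigma> A A"
      and \<pi>: "\<pi> \<in> carrier G" "compose (univ A) \<pi> e = compose (univ A) e \<sigma>" "gact X x \<pi> = x"
      by (auto simp: S_def)
    have "gact X x \<one>\<^bsub>G\<^esub> = gact X x \<pi>"
      using gact_one[OF X x] \<pi>(3) by simp
    \<comment> \<open>Both the identity and \<open>\<pi>\<close> stabilize \<open>x\<close>, so
      \<open>key\<close> provides \<open>\<tau>\<close> in \<open>S\<close> with
      \<open>e = e \<circ> \<sigma> \<circ> \<tau>\<close>.\<close>
    then obtain \<tau> where \<tau>: "\<tau> \<in> S"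
      "compose (univ A) \<one>\<^bsub>G\<^esub> e = compose (univ A) (compose (univ A) \<pi> e) \<tau>"
      using key[OF G.one_closed \<pi>(1)] by blast
    have \<tau>i: "\<tau> \<in> isomorphisms \<Sigma> A A"
      using \<tau>(1) by (simp add: S_def)
    note \<sigma>e = isomorphisms_embeddings[OF \<sigma>] and \<tau>e = isomorphisms_embeddings[OF \<tau>i]
    have "compose (univ A) e (compose (univ A) \<sigma> \<tau>) = compose (univ A) e (\<lambda>x \<in> univ A. x)"
      using \<tau>(2) embeddings_compose_assoc[OF \<tau>e, of e \<sigma>] \<pi>(2) embeddings_compose_id[OF e] by simp
    then have "compose (univ A) \<sigma> \<tau> = (\<lambda>x \<in> univ A. x)"
      by (rule embeddings_cancel[OF e embeddings_compose[OF \<tau>e \<sigma>e] embeddings_id])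
    \<comment> \<open>The product performs its left factor first, so a right inverse under
      composition is a left inverse in the group, as \<open>inv_equality\<close> requires.\<close>
    then have "inv\<^bsub>aut_group \<Sigma> A\<^esub> \<sigma> = \<tau>"
      using \<sigma> \<tau>i by (intro group.inv_equality[OF group_aut_group]) auto
    then show "inv\<^bsub>aut_group \<Sigma> A\<^esub> \<sigma> \<in> S"
      using \<tau>(1) by simp
  qed
  have pt_iff: "pt A S (compose (univ A) \<pi> e) = pt A S (compose (univ A) \<pi>' e) \<longleftrightarrow>
      gact X x \<pi> = gact X x \<pi>'" if \<pi>: "\<pi> \<in> carrier G" "\<pi>' \<in> carrier G" for \<pi> \<pi>'
  proof -
    have emb: "compose (univ A) \<pi> e \<in> embeddings \<Sigma> A U" "compose (univ A) \<pi>' e \<in> embeddings \<Sigma> A U"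
      using \<pi> embeddings_automorphism[OF _ e] by auto
    show ?thesis
      using pt_eq_iff[OF A emb] eclass_eq_iff[OF S emb] key[OF \<pi>(2,1)] by metis
  qed
  \<comment> \<open>Some group element taking \<open>x\<close> to \<open>y\<close> is chosen; by
    \<open>pt_iff\<close> any other choice gives the same point.\<close>
  define t where "t = (\<lambda>y \<in> gcarrier X.
    pt A S (compose (univ A) (inv_into (carrier G) (gact X x) y) e))"
  have t: "t (gact X x \<pi>) = pt A S (compose (univ A) \<pi> e)" if \<pi>: "\<pi> \<in> carrier G" for \<pi>
  proof -
    have "gact X x \<pi> \<in> gact X x ` carrier G"
      using \<pi> by blast
    from inv_into_into[OF this] f_inv_into_f[OF this] show ?thesis
      using pt_iff[OF _ \<pi>] gact_closed[OF X x \<pi>] by (simp add: t_def del: aut_group_simps)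
  qed
  have t_eq: "t \<in> equivariant_maps G X (orb A S)"
  proof -
    have "t (gact X x \<pi>) \<in> gcarrier (orb A S)" if "\<pi> \<in> carrier G" for \<pi>
      using that t pt_in_orb embeddings_automorphism[OF _ e] by simp
    moreover have "t (gact X (gact X x \<pi>) \<rho>) = gact (orb A S) (t (gact X x \<pi>)) \<rho>"
      if "\<pi> \<in> carrier G" "\<rho> \<in> carrier G" for \<pi> \<rho>
    proof -
      have "t (gact X (gact X x \<pi>) \<rho>) = pt A S (compose (univ A) (\<pi> \<otimes>\<^bsub>G\<^esub> \<rho>) e)"
        using t[OF G.m_closed[OF that]] gact_mult[OF X x that] by simp
      then show ?thesis
        using that t[OF that(1)] gact_orb[OF A S embeddings_automorphism[OF _ e]] mult_e by simp
    qed
    moreover have "t \<in> extensional (gcarrier X)"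
      by (simp add: t_def)
    ultimately show ?thesis
      by (auto simp: equivariant_maps_def PiE_iff X_eq)
  qed
  have "inj_on t (gcarrier X)"
    using t pt_iff by (auto simp: inj_on_def X_eq)
  moreover have "gcarrier (orb A S) \<subseteq> t ` gcarrier X"
  proof
    fix y assume "y \<in> gcarrier (orb A S)"
    then obtain d where d: "d \<in> embeddings \<Sigma> A U" "y = pt A S d"
      by (auto simp: gcarrier_orb)
    obtain \<pi> where "\<pi> \<in> isomorphisms \<Sigma> U U" "compose (univ A) \<pi> e = d"
      using homogeneous_embeddings[OF A e d(1)] .
    then have "y = t (gact X x \<pi>)" "gact X x \<pi> \<in> gcarrier X"
      using t[of \<pi>] d(2) X_eq by simp_all
    then show "y \<in> t ` gcarrier X"
      by (rule image_eqI)
  qed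
  ultimately have "bij_betw t (gcarrier X) (gcarrier (orb A S))"
    unfolding bij_betw_def using equivariant_maps_apply[OF t_eq] by blast
  then show thesis
    by (rule that[OF A S is_iso_single_orbit_nominal_cat[OF X t_eq]])
qed

section \<open>Functoriality and the equivalence\<close>

lemma is_functor_orb:
  "is_functor (structure_subgroup_cat \<Sigma> K) (single_orbit_nominal_cat (univ U) G)
    (\<lambda>(A, S). orb A S) (\<lambda>(A, S) (B, T). orb_map A S B T)"
  (is "is_functor ?C ?D ?F0 ?F1")
  unfolding is_functor_def
proof (intro conjI ballI)
  fix P assume "P \<in> Obj ?C"
  then show "?F0 P \<in> Obj ?D"
    by (auto simp: structure_subgroup_cat_Obj nominal_orb single_orbit_orb)
next
  fix P Q f assume "P \<in> Obj ?C" "Q \<in> Obj ?C" "f \<in> Arr ?C P Q"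
  then show "?F1 P Q f \<in> Arr ?D (?F0 P) (?F0 Q)"
    by (auto simp: structure_subgroup_cat_Obj structure_subgroup_cat_Arr orb_map_equivariant)
next
  fix P assume "P \<in> Obj ?C"
  then obtain A S where P: "P = (A, S)" and A: "A \<in> K" "subgroup S (aut_group \<Sigma> A)"
    by (auto simp: structure_subgroup_cat_Obj)
  note adm = admissible_embeddings_id[OF A(2)]
  have "orb_map A S A S (eclass A S (\<lambda>x \<in> univ A. x)) = (\<lambda>x \<in> gcarrier (orb A S). x)"
  proof (rule equivariant_maps_eqI[OF orb_map_equivariant[OF A A adm]])
    show "(\<lambda>x \<in> gcarrier (orb A S). x) \<in> equivariant_maps G (orb A S) (orb A S)"
      by (auto simp: equivariant_maps_def gact_closed[OF is_gset_orb[OF A]])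
  qed (auto simp: gcarrier_orb orb_map_pt[OF A A adm] embeddings_compose_id)
  then show "?F1 P P (Ide ?C P) = Ide ?D (?F0 P)"
    using A by (simp add: P structure_subgroup_cat_Ide)
next
  fix P Q R f g
  assume "P \<in> Obj ?C" "Q \<in> Obj ?C" "R \<in> Obj ?C" "f \<in> Arr ?C P Q" "g \<in> Arr ?C Q R"
  then obtain A S B T C V u v where eq: "P = (A, S)" "Q = (B, T)" "R = (C, V)"
    "f = eclass B T u" "g = eclass C V v"
    and A: "A \<in> K" "subgroup S (aut_group \<Sigma> A)" and B: "B \<in> K" "subgroup T (aut_group \<Sigma> B)"
    and C: "C \<in> K" "subgroup V (aut_group \<Sigma> C)"
    and u: "u \<in> admissible_embeddings \<Sigma> (A, S) (B, T)" and v: "v \<in> admissible_embeddings \<Sigma> (B, T) (C, V)"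
    by (auto simp: structure_subgroup_cat_Obj structure_subgroup_cat_Arr)
  note ue = admissible_embeddings_embeddings[OF u] and ve = admissible_embeddings_embeddings[OF v]
  note uv = admissible_embeddings_compose[OF B(2) C(2) u v]
  \<comment> \<open>Evaluated at \<open>[e]\<close>, the two sides are
    \<open>[e \<circ> (u \<circ> v)]\<close> and \<open>[(e \<circ> u) \<circ> v]\<close>: the
    reversed direction of the embeddings makes the functor covariant.\<close>
  have "orb_map A S C V (eclass C V (compose (univ C) u v)) =
      compose (gcarrier (orb A S)) (orb_map B T C V (eclass C V v)) (orb_map A S B T (eclass B T u))"
  proof (rule extensionalityI)
    show "orb_map A S C V (eclass C V (compose (univ C) u v)) \<in> extensional (gcarrier (orb A S))"
      by (simp add: orb_map_def)
    fix x assume "x \<in> gcarrier (orb A S)"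
    then show "orb_map A S C V (eclass C V (compose (univ C) u v)) x =
      compose (gcarrier (orb A S)) (orb_map B T C V (eclass C V v)) (orb_map A S B T (eclass B T u)) x"
      by (auto simp: gcarrier_orb compose_eq orb_map_pt[OF A C uv] orb_map_pt[OF A B u]
          orb_map_pt[OF B C v] embeddings_compose[OF ue] embeddings_compose_assoc[OF ve])
  qed simp
  then show "?F1 P R (Cmp ?C P Q R g f) = Cmp ?D (?F0 P) (?F0 Q) (?F0 R) (?F1 Q R g) (?F1 P Q f)"
    by (simp add: eq structure_subgroup_cat_Cmp[OF B(2) C(2) ue v])
qed

lemma equivalent_categories_orbits_structures:
  "equivalent_categories
    (single_orbit_nominal_cat (univ U) G :: (('x, 'd \<Rightarrow> 'd) gset, 'x \<Rightarrow> 'x) category)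
    (structure_subgroup_cat \<Sigma> K)"
proof (rule equivalent_categories_if_fully_faithful_ess_surj[OF is_category_single_orbit_nominal_cat
      is_category_structure_subgroup_cat is_functor_orb])
  fix P Q f assume "P \<in> Obj (structure_subgroup_cat \<Sigma> K)" "Q \<in> Obj (structure_subgroup_cat \<Sigma> K)"
    and f: "f \<in> Arr (single_orbit_nominal_cat (univ U) G) (case P of (A, S) \<Rightarrow> orb A S) (case Q of (A, S) \<Rightarrow> orb A S)"
  then obtain A S B T where eq: "P = (A, S)" "Q = (B, T)"
    and A: "A \<in> K" "subgroup S (aut_group \<Sigma> A)" and B: "B \<in> K" "subgroup T (aut_group \<Sigma> B)"
    by (auto simp: structure_subgroup_cat_Obj)
  then obtain u where "u \<in> admissible_embeddings \<Sigma> (A, S) (B, T)" "orb_map A S B T (eclass B T u) = f"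
    using orb_map_full[OF A B, of f] f by auto
  then show "\<exists>g \<in> Arr (structure_subgroup_cat \<Sigma> K) P Q. (case P of (A, S) \<Rightarrow> \<lambda>(B, T). orb_map A S B T) Q g = f"
    by (auto simp: eq structure_subgroup_cat_Arr[OF B(2)])
next
  fix P Q f g assume "P \<in> Obj (structure_subgroup_cat \<Sigma> K)" "Q \<in> Obj (structure_subgroup_cat \<Sigma> K)"
    and fg: "f \<in> Arr (structure_subgroup_cat \<Sigma> K) P Q" "g \<in> Arr (structure_subgroup_cat \<Sigma> K) P Q"
    "(case P of (A, S) \<Rightarrow> \<lambda>(B, T). orb_map A S B T) Q f = (case P of (A, S) \<Rightarrow> \<lambda>(B, T). orb_map A S B T) Q g"
  then obtain A S B T where eq: "P = (A, S)" "Q = (B, T)"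
    and A: "A \<in> K" "subgroup S (aut_group \<Sigma> A)" and B: "B \<in> K" "subgroup T (aut_group \<Sigma> B)"
    by (auto simp: structure_subgroup_cat_Obj)
  then show "f = g"
    using fg orb_map_faithful[OF A B] by (clarsimp simp: structure_subgroup_cat_Arr[OF B(2)])
next
  fix X :: "('x, 'd \<Rightarrow> 'd) gset"
  assume "X \<in> Obj (single_orbit_nominal_cat (univ U) G)"
  then obtain A S t where "A \<in> K" "subgroup S (aut_group \<Sigma> A)"
    "is_iso (single_orbit_nominal_cat (univ U) G) X (orb A S) t"
    using orb_ess_surj[of X] by (metis single_orbit_nominal_cat_simps(1))
  then show "\<exists>P \<in> Obj (structure_subgroup_cat \<Sigma> K). \<exists>t.
      is_iso (single_orbit_nominal_cat (univ U) G) X (case P of (A, S) \<Rightarrow> orb A S) t"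
    by (intro bexI[of _ "(A, S)"]) (auto simp: structure_subgroup_cat_Obj)
qed

end

theorem theorem10p9:
  fixes \<Sigma> :: "'r signature"
    and K :: "('a, 'r) relstruct set"
    and U :: "('d, 'r) relstruct"
  assumes "finite (syms \<Sigma>)"
    and "fraisse_class \<Sigma> K"
    and "fraisse_limit \<Sigma> K U"
    and "infinite (UNIV :: 'x set)"
    and "well_behaved TYPE('x) (univ U) (aut_group \<Sigma> U)"
  shows "equivalent_categories
    (single_orbit_nominal_cat (univ U) (aut_group \<Sigma> U) :: (('x, 'd \<Rightarrow> 'd) gset, 'x \<Rightarrow> 'x) category)
    (structure_subgroup_cat \<Sigma> K)"
proof -
  interpret well_behaved_fraisse_symmetry \<Sigma> K U "TYPE('x)"
    using assms(2-5) by unfold_locales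
  show ?thesis
    by (rule equivalent_categories_orbits_structures)
qed

end
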